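(* Let $n\ge2$ and let $\mathcal I^M[\mathbf v_1,\dots,\mathbf v_n]$ be the syzygy ideal of the multilinear ring $\mathcal Q^M[\mathbf v_1,\dots,\mathbf v_n]$ of multilinear quaternionic polynomials in $n$ vector variables $\mathbf v_1\prec\mathbf v_2\prec\dots\prec\mathbf v_n$. (1) [Gröbner base] The following elements form a reduced Gröbner base of $\mathcal I^M[\mathbf v_1,\dots,\mathbf v_n]$: for all $1\le i_1<i_2<\dots<i_m\le n$, - G3 ($m=3$): $[\mathbf v_{i_3}\mathbf v_{i_2}\mathbf v_{i_1}]-[\mathbf v_{i_1}\mathbf v_{i_3}\mathbf v_{i_2}]$ and $[\mathbf v_{i_3}\mathbf v_{i_1}\mathbf v_{i_2}]-[\mathbf v_{i_2}\mathbf v_{i_3}\mathbf v_{i_1}]$; - G$m$ ($4\le m\le n$): $[\mathbf v_{i_3}\mathbf v_{i_2}\mathbf V\mathbf v_{i_1}]-[\mathbf v_{i_2}\mathbf V\mathbf v_{i_1}\mathbf v_{i_3}]$, where $\mathbf V=\mathbf v_{i_4}\mathbf v_{i_5}\cdots\mathbf v_{i_m}$. (2) [Normal form] In a normal form with respect to this Gröbner base, every term is, up to coefficient, of the form $$\mathbf V_{Y_1}\mathbf v_{z_1}\mathbf V_{Y_2}\mathbf v_{z_2}\cdots\mathbf V_{Y_k}\mathbf v_{z_k}\quad\text{or}\quad \mathbf V_{Y_1}\mathbf v_{z_1}\cdots\mathbf V_{Y_k}\mathbf v_{z_k}\mathbf V_{Y_{k+1}},$$ where (i) $k\ge0$; (ii)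 $\mathbf v_{z_1}\mathbf v_{z_2}\cdots\mathbf v_{z_k}$ is ascending; (iii) every $\mathbf V_{Y_i}$ is an ascending monomial of length $\ge1$; (iv) $\mathbf V_{Y_1}\mathbf V_{Y_2}\cdots\mathbf V_{Y_k}$ (or $\mathbf V_{Y_1}\mathbf V_{Y_2}\cdots\mathbf V_{Y_{k+1}}$ if $\mathbf V_{Y_{k+1}}$ occurs) is ascending; (v) for every $i\le k$, if $\mathbf v_{t_i}$ is the trailing variable of the monomial $\mathbf V_{Y_i}$, then $\mathbf v_{z_i}\prec\mathbf v_{t_i}$.
   Context: Monomials here are formal noncommutative words in $\mathbf v_1,\dots,\mathbf v_n$ (times rational coefficients), with juxtaposition as product. A monomial is multilinear if every variable occurs at most once. A multilinear polynomial is a $\mathbb Q$-linear combination of multilinear monomials all having the same set of variables (including polynomials of degree $0$). The multilinear ring $\mathcal Q^M[\mathbf v_1,\dots,\mathbf v_n]$ consists of all multilinear polynomials in these variables, with the product of two polynomials defined only when they have no common variable, and addition defined only for polynomials having the same set of variables. Ideals are defined as usual, using only these partially defined operations. For a monomial $\mathbf W=\mathbf v_{j_1}\cdots\mathbf v_{j_m}$, its reversion is $\mathbf W^\dagger=\mathbf v_{j_m}\cdots\mathbf v_{j_1}$, and $[\mathbf W]:=(\mathbf W+(-1)^m\mathbf W^\dagger)/2$. The syzygy ideal $\mathcal I^M[\mathbf v_1,\dots,\mathbf v_n]$ is the two-sided ideal of the multilinear ring generated by the elements $[\mathbf v_a\mathbf v_b]\mathbf v_c-\mathbf v_c[\mathbf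 v_a\mathbf v_b]$ and $[\mathbf v_a\mathbf v_b\mathbf v_c]\mathbf v_d-\mathbf v_d[\mathbf v_a\mathbf v_b\mathbf v_c]$ for all pairwise distinct $a,b,c,d\in\{1,\dots,n\}$. A monomial $\mathbf v_{j_1}\cdots\mathbf v_{j_m}$ is ascending if $j_1<\dots<j_m$; its trailing variable is $\mathbf v_{j_m}$. Monomials are ordered lexicographically with respect to $\mathbf v_1\prec\dots\prec\mathbf v_n$; the leading term of a polynomial is its term of highest order. A monomial $h_1$ is a multiplier of $h_2$ (and $h_2$ a factor of $h_1$) if $h_1=l\,h_2\,r$ for some monomials $l,r$ (possibly rational constants); otherwise $h_1$ is reduced with respect to $h_2$. A polynomial $f$ is reduced with respect to $g$ if the leading term of $f$ is reduced with respect to that of $g$. A set $\{g_i\}$ is a reduced Gröbner base of an ideal $\mathcal I$ if (a) it generates $\mathcal I$; (b) the leading term of every nonzero element of $\mathcal I$ is a multiplier of the leading term of some $g_i$; (c) the $g_i$ are pairwise reduced with respect to each other. The normal form of a polynomial is the result of repeatedly replacing a non-reduced term by its remainder upon division by a $g_i$ whose leading term is a factor of it, until no term is a multiplier of the leading term of any $g_i$. *)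

theory Defs
  imports Complex_Main "HOL-Library.Poly_Mapping" "HOL-Library.List_Lexorder"
begin

text \<open>
  The variable \<open>v\<^sub>i\<close> is the letter \<open>i\<close>, a monomial is a word, and words form a monoid under
  concatenation, written additively because \<^theory>\<open>HOL-Library.Poly_Mapping\<close> writes exponents
  additively.  With this instance, \<open>nat list \<Rightarrow>\<^sub>0 rat\<close> is the free associative algebra over the
  rationals.  The order on \<open>nat list\<close> is the lexicographic one of
  \<^theory>\<open>HOL-Library.List_Lexorder\<close>.
\<close>

instantiation list :: (type) monoid_add
begin

definition zero_list :: "'a list" where
  "zero_list = []"

definition plus_list :: "'a list \<Rightarrow> 'a list \<Rightarrow> 'a list" where
  "plus_list u w = u @ w"

instance
  by standard (simp_all add: zero_list_def plus_list_def)

end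

type_synonym ncpoly = "nat list \<Rightarrow>\<^sub>0 rat"

abbreviation var :: "nat \<Rightarrow> ncpoly" where
  "var i \<equiv> Poly_Mapping.single [i] 1"

definition is_monomial :: "ncpoly \<Rightarrow> bool" where
  "is_monomial h \<longleftrightarrow> (\<exists>w c. c \<noteq> 0 \<and> h = Poly_Mapping.single w c)"

text \<open>
  The multilinear ring.  \<open>ml_part S\<close> consists of the polynomials whose terms all have variable set
  exactly \<open>S\<close>, each variable occurring once.  The partial operations are the restrictions of the
  total operations of the free algebra: a sum is defined within one \<open>ml_part S\<close>, a product between
  \<open>ml_part S\<close> and \<open>ml_part T\<close> for disjoint \<open>S\<close> and \<open>T\<close>.  The zero polynomial lies in every
  \<open>ml_part S\<close>.
\<close>

definition ml_part :: "nat set \<Rightarrow> ncpoly set" where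
  "ml_part S = {f. \<forall>w \<in> Poly_Mapping.keys f. distinct w \<and> set w = S}"

definition ml_ring :: "nat \<Rightarrow> ncpoly set" where
  "ml_ring n = (\<Union>S \<in> Pow {1..n}. ml_part S)"

text \<open>Closure under negation is multiplication by the degree-0 polynomial \<open>-1\<close>.\<close>

definition ml_ideal :: "nat \<Rightarrow> ncpoly set \<Rightarrow> bool" where
  "ml_ideal n I \<longleftrightarrow>
     I \<subseteq> ml_ring n \<and> 0 \<in> I \<and>
     (\<forall>S \<subseteq> {1..n}. \<forall>f \<in> I \<inter> ml_part S. \<forall>g \<in> I \<inter> ml_part S. f + g \<in> I) \<and>
     (\<forall>S \<subseteq> {1..n}. \<forall>T \<subseteq> {1..n}. S \<inter> T = {} \<longrightarrow>
        (\<forall>f \<in> I \<inter> ml_part S. \<forall>q \<in> ml_part T. q * f \<in> I \<and> f * q \<in> I))"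

definition ideal_generated :: "nat \<Rightarrow> ncpoly set \<Rightarrow> ncpoly set" where
  "ideal_generated n X = \<Inter>{I. ml_ideal n I \<and> X \<subseteq> I}"

definition brk :: "nat list \<Rightarrow> ncpoly" where
  "brk w = Poly_Mapping.single w (1/2) + Poly_Mapping.single (rev w) ((-1) ^ length w / 2)"

definition syzygy_generators :: "nat \<Rightarrow> ncpoly set" where
  "syzygy_generators n =
     {brk [a, b] * var c - var c * brk [a, b] | a b c.
        distinct [a, b, c] \<and> {a, b, c} \<subseteq> {1..n}} \<union>
     {brk [a, b, c] * var d - var d * brk [a, b, c] | a b c d.
        distinct [a, b, c, d] \<and> {a, b, c, d} \<subseteq> {1..n}}"

definition syzygy_ideal :: "nat \<Rightarrow> ncpoly set" where
  "syzygy_ideal n = ideal_generated n (syzygy_generators n)"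

definition terms :: "ncpoly \<Rightarrow> ncpoly set" where
  "terms f = {Poly_Mapping.single w (Poly_Mapping.lookup f w) | w. w \<in> Poly_Mapping.keys f}"

text \<open>Meaningful for \<open>f \<noteq> 0\<close> only.\<close>

definition lead_term :: "ncpoly \<Rightarrow> ncpoly" where
  "lead_term f = (let w = Max (Poly_Mapping.keys f)
                  in Poly_Mapping.single w (Poly_Mapping.lookup f w))"

definition multiplier :: "ncpoly \<Rightarrow> ncpoly \<Rightarrow> bool" where
  "multiplier h1 h2 \<longleftrightarrow> (\<exists>l r. is_monomial l \<and> is_monomial r \<and> h1 = l * h2 * r)"

definition reduced_wrt :: "ncpoly \<Rightarrow> ncpoly \<Rightarrow> bool" where
  "reduced_wrt f g \<longleftrightarrow> \<not> multiplier (lead_term f) (lead_term g)"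

text \<open>
  The elements of a base are required to be nonzero, as leading terms only exist for such
  polynomials.
\<close>

definition reduced_groebner_base :: "nat \<Rightarrow> ncpoly set \<Rightarrow> ncpoly set \<Rightarrow> bool" where
  "reduced_groebner_base n G I \<longleftrightarrow>
     G \<subseteq> ml_ring n \<and> 0 \<notin> G \<and>
     ideal_generated n G = I \<and>
     (\<forall>f \<in> I. f \<noteq> 0 \<longrightarrow> (\<exists>g \<in> G. multiplier (lead_term f) (lead_term g))) \<and>
     (\<forall>f \<in> G. \<forall>g \<in> G. f \<noteq> g \<longrightarrow> reduced_wrt f g)"

text \<open>
  One step replaces a term \<open>h = l * lead_term g * r\<close> of \<open>f\<close> by its remainder \<open>h - l * g * r\<close>.
\<close>

definition reduction_step :: "ncpoly set \<Rightarrow> ncpoly \<Rightarrow> ncpoly \<Rightarrow> bool" where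
  "reduction_step G f f' \<longleftrightarrow>
     (\<exists>h \<in> terms f. \<exists>g \<in> G. \<exists>l r. is_monomial l \<and> is_monomial r \<and>
        h = l * lead_term g * r \<and> f' = (f - h) + (h - l * g * r))"

definition is_normal_form_of :: "ncpoly set \<Rightarrow> ncpoly \<Rightarrow> ncpoly \<Rightarrow> bool" where
  "is_normal_form_of G h f \<longleftrightarrow>
     (reduction_step G)\<^sup>*\<^sup>* f h \<and> (\<forall>t \<in> terms h. \<forall>g \<in> G. \<not> multiplier t (lead_term g))"

definition ascending :: "nat list \<Rightarrow> bool" where
  "ascending w \<longleftrightarrow> sorted_wrt (<) w"

definition G3 :: "nat \<Rightarrow> ncpoly set" where
  "G3 n =
     {brk [i3, i2, i1] - brk [i1, i3, i2] | i1 i2 i3. 1 \<le> i1 \<and> i1 < i2 \<and> i2 < i3 \<and> i3 \<le> n} \<union>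
     {brk [i3, i1, i2] - brk [i2, i3, i1] | i1 i2 i3. 1 \<le> i1 \<and> i1 < i2 \<and> i2 < i3 \<and> i3 \<le> n}"

text \<open>Here \<open>V\<close> is \<open>v\<^bsub>i4\<^esub> \<dots> v\<^bsub>im\<^esub>\<close>, so \<open>m = length V + 3\<close>; \<open>V \<noteq> []\<close> says \<open>m \<ge> 4\<close>.\<close>

definition Gm :: "nat \<Rightarrow> ncpoly set" where
  "Gm n =
     {brk ([i3, i2] @ V @ [i1]) - brk ([i2] @ V @ [i1, i3]) | i1 i2 i3 V.
        V \<noteq> [] \<and> ascending ([i1, i2, i3] @ V) \<and> set ([i1, i2, i3] @ V) \<subseteq> {1..n}}"

definition syzygy_base :: "nat \<Rightarrow> ncpoly set" where
  "syzygy_base n = G3 n \<union> Gm n"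

text \<open>
  In \<open>normal_word\<close>, \<open>Ys ! i\<close> and \<open>zs ! i\<close> (counted from 0) are \<open>V\<^bsub>Y(i+1)\<^esub>\<close> and \<open>z\<^bsub>i+1\<^esub>\<close>.  As \<open>zip\<close> stops
  at the end of the shorter list, \<open>interleave Ys zs\<close> ignores the extra last block when
  \<open>length Ys = length zs + 1\<close>.
\<close>

definition interleave :: "nat list list \<Rightarrow> nat list \<Rightarrow> nat list" where
  "interleave Ys zs = concat (map (\<lambda>(Y, z). Y @ [z]) (zip Ys zs))"

definition normal_word :: "nat \<Rightarrow> nat list \<Rightarrow> bool" where
  "normal_word n w \<longleftrightarrow>
     distinct w \<and> set w \<subseteq> {1..n} \<and>
     (\<exists>k Ys zs.
        length zs = k \<and>
        (length Ys = k \<and> w = interleave Ys zs \<or>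
         length Ys = k + 1 \<and> w = interleave Ys zs @ Ys ! k) \<and>
        ascending zs \<and>
        (\<forall>Y \<in> set Ys. ascending Y \<and> length Y \<ge> 1) \<and>
        ascending (concat Ys) \<and>
        (\<forall>i < k. zs ! i < last (Ys ! i)))"

end

theory Submission
  imports Defs
begin

text \<open>
  The proof rests on two facts about the syzygy ideal \<open>I\<close>, one for each side of the Groebner base
  property.

  The base lies in \<open>I\<close>.  Modulo \<open>I\<close>, the bracket \<open>[W]\<close> of every word commutes
  with all other variables, as the scalar part of a quaternion does (\<open>central_brk\<close>).  This is
  an induction on the length, in which the expansion of a product of three vectors expresses \<open>[abcW]\<close>
  by products of shorter brackets.  Since \<open>[aU] - [Ua] = a[U] - [U]a\<close>, brackets are then invariant under
  cyclic rotation modulo \<open>I\<close> (\<open>brk_rotate\<close>), and every base element is the difference of the brackets of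
  two rotations of one word.

  No element of \<open>I\<close> has an irreducible leading word.  A word without a factor that is the leading
  word of a base element has the block structure of the normal form (\<open>block_form_exists\<close>); this is
  the second part of the theorem.  For such a word, substitute \<open>2 \<times> 2\<close> matrices of trace zero for the
  variables: \<open>F\<close> for each \<open>z\<^sub>i\<close>, \<open>E\<close> for each trailing variable \<open>t\<^sub>i\<close> of a block followed by \<open>z\<^sub>i\<close>, and \<open>H\<close>
  for the other letters, where \<open>E, F, H\<close> is the usual basis of \<open>sl\<^sub>2\<close>.  The elements of \<open>I\<close> vanish under
  this substitution (\<open>syzygy_ideal_evaluates_zero\<close>).  The upper left entry of the matrix product is 1 for
  the word itself and 0 for every lexicographically smaller arrangement of its letters
  (\<open>separating_entry\<close>, \<open>separating_smaller_entry\<close>).  So a polynomial with this leading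
  word has a nonzero image and is not in \<open>I\<close> (\<open>lead_word_has_obstruction\<close>).

  Hence the leading word of every nonzero element of \<open>I\<close> is reducible, and division by the base shows that
  the base generates \<open>I\<close> (\<open>syzygy_ideal_subset_generated\<close>).
\<close>

section \<open>Induction over noncommutative polynomials\<close>

lemma poly_mapping_monomial_induct [case_names zero add]:
  fixes f :: "'a \<Rightarrow>\<^sub>0 'b::comm_monoid_add"
  assumes "P 0" and "\<And>f k c. P f \<Longrightarrow> P (f + Poly_Mapping.single k c)"
  shows "P f"
proof (induction f rule: Poly_Mapping.update_induct)
  case const
  then show ?case by (rule assms(1))
next
  case (update f k c)
  then have "Poly_Mapping.update k c f = f + Poly_Mapping.single k c"
    by (intro poly_mapping_eqI) (auto simp: lookup_update lookup_add lookup_single when_def in_keys_iff)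
  then show ?case using assms(2) update by metis
qed

lemma scalar_commutes: "f * Poly_Mapping.single [] c = Poly_Mapping.single [] c * (f :: ncpoly)"
  by (induction f rule: poly_mapping_monomial_induct)
    (simp_all add: distrib_left distrib_right mult_single plus_list_def mult.commute)

section \<open>Homogeneous components of the multilinear ring\<close>

lemma ml_part_zero [simp]: "0 \<in> ml_part S"
  by (simp add: ml_part_def)

lemma ml_part_single [simp]:
  "Poly_Mapping.single w c \<in> ml_part S \<longleftrightarrow> c = 0 \<or> distinct w \<and> set w = S"
  by (auto simp: ml_part_def)

lemma ml_part_add: "f \<in> ml_part S \<Longrightarrow> g \<in> ml_part S \<Longrightarrow> f + g \<in> ml_part S"
  using Poly_Mapping.keys_add[of f g] by (auto simp: ml_part_def)

lemma ml_part_uminus: "f \<in> ml_part S \<Longrightarrow> - f \<in> ml_part S"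
  by (simp add: ml_part_def in_keys_iff)

lemma ml_part_diff: "f \<in> ml_part S \<Longrightarrow> g \<in> ml_part S \<Longrightarrow> f - g \<in> ml_part S"
  using ml_part_add[of f S "- g"] ml_part_uminus[of g S] by simp

lemma ml_part_mult:
  assumes "f \<in> ml_part S" "g \<in> ml_part T" "S \<inter> T = {}"
  shows "f * g \<in> ml_part (S \<union> T)"
  unfolding ml_part_def
proof (intro CollectI ballI)
  fix w assume "w \<in> Poly_Mapping.keys (f * g)"
  then obtain u v where "u \<in> Poly_Mapping.keys f" "v \<in> Poly_Mapping.keys g" "w = u @ v"
    using Poly_Mapping.keys_mult[of f g] by (auto simp: plus_list_def)
  then show "distinct w \<and> set w = S \<union> T"
    using assms by (simp add: ml_part_def)
qed

lemma ml_part_one: "1 \<in> ml_part {}"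
proof -
  have "1 = (Poly_Mapping.single [] 1 :: ncpoly)"
    unfolding zero_list_def[symmetric] by (rule single_one[symmetric])
  also have "\<dots> \<in> ml_part {}" by simp
  finally show ?thesis .
qed

lemma ml_partD: "f \<in> ml_part S \<Longrightarrow> w \<in> Poly_Mapping.keys f \<Longrightarrow> distinct w \<and> set w = S"
  by (simp add: ml_part_def)

lemma ml_ringI: "S \<subseteq> {1..n} \<Longrightarrow> f \<in> ml_part S \<Longrightarrow> f \<in> ml_ring n"
  by (auto simp: ml_ring_def)

lemma ml_ringE:
  assumes "f \<in> ml_ring n"
  obtains S where "S \<subseteq> {1..n}" "f \<in> ml_part S"
  using assms by (auto simp: ml_ring_def)

lemma ml_ideal_ring: "ml_ideal n (ml_ring n)"
  unfolding ml_ideal_def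
proof (intro conjI allI ballI impI)
  show "0 \<in> ml_ring n" by (rule ml_ringI[of "{}"]) auto
next
  fix S f g assume "S \<subseteq> {1..n}" "f \<in> ml_ring n \<inter> ml_part S" "g \<in> ml_ring n \<inter> ml_part S"
  then have "f + g \<in> ml_part S" by (auto intro: ml_part_add)
  then show "f + g \<in> ml_ring n" using \<open>S \<subseteq> {1..n}\<close> by (rule ml_ringI[rotated])
next
  fix S T f q assume *: "S \<subseteq> {1..n}" "T \<subseteq> {1..n}" "S \<inter> T = {}"
    "f \<in> ml_ring n \<inter> ml_part S" "q \<in> ml_part T"
  then have "q * f \<in> ml_part (T \<union> S)" "f * q \<in> ml_part (S \<union> T)"
    by (auto intro: ml_part_mult)
  moreover have "T \<union> S \<subseteq> {1..n}" "S \<union> T \<subseteq> {1..n}" using * by auto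
  ultimately show "q * f \<in> ml_ring n" "f * q \<in> ml_ring n" by (simp_all only: ml_ringI)
qed simp

text \<open>
  The multilinear ring is itself closed under the partial operations, so the intersection that
  defines the generated ideal is not over an empty family and is again an ideal.
\<close>

lemma ml_ideal_generated:
  assumes "X \<subseteq> ml_ring n"
  shows "ml_ideal n (ideal_generated n X)"
proof -
  have "ideal_generated n X \<subseteq> ml_ring n"
    unfolding ideal_generated_def using assms ml_ideal_ring[of n] by (intro Inter_lower) simp
  show ?thesis
    unfolding ml_ideal_def
  proof (intro conjI allI ballI impI)
    show "ideal_generated n X \<subseteq> ml_ring n" by fact
    show "0 \<in> ideal_generated n X"
      by (simp add: ideal_generated_def ml_ideal_def)
  next
    fix S f g
    assume "S \<subseteq> {1..n}" "f \<in> ideal_generated n X \<inter> ml_part S" "g \<in> ideal_generated n X \<inter> ml_part S"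
    then show "f + g \<in> ideal_generated n X"
      unfolding ideal_generated_def by (simp add: ml_ideal_def)
  next
    fix S T f q
    assume "S \<subseteq> {1..n}" "T \<subseteq> {1..n}" "S \<inter> T = {}" "f \<in> ideal_generated n X \<inter> ml_part S" "q \<in> ml_part T"
    then show "q * f \<in> ideal_generated n X" "f * q \<in> ideal_generated n X"
      unfolding ideal_generated_def by (simp_all add: ml_ideal_def)
  qed
qed

lemma ideal_generated_superset: "X \<subseteq> ideal_generated n X"
  by (auto simp: ideal_generated_def)

lemma ideal_generated_least: "ml_ideal n I \<Longrightarrow> X \<subseteq> I \<Longrightarrow> ideal_generated n X \<subseteq> I"
  by (auto simp: ideal_generated_def)

lemma brk_ml_part: "distinct w \<Longrightarrow> set w = S \<Longrightarrow> brk w \<in> ml_part S"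
  by (auto simp: brk_def intro!: ml_part_add)

lemma syzygy_generators_ml_ring: "syzygy_generators n \<subseteq> ml_ring n"
proof
  have commutator: "brk w * var d - var d * brk w \<in> ml_ring n"
    if "distinct (d # w)" "set (d # w) \<subseteq> {1..n}" for w d
  proof -
    have "brk w \<in> ml_part (set w)" "var d \<in> ml_part {d}" "set w \<inter> {d} = {}"
      using that(1) by (simp_all add: brk_ml_part)
    then have "brk w * var d \<in> ml_part (set w \<union> {d})" "var d * brk w \<in> ml_part ({d} \<union> set w)"
      by (simp_all only: ml_part_mult Int_commute)
    moreover have "set w \<union> {d} = set (d # w)" "{d} \<union> set w = set (d # w)"
      by auto
    ultimately have "brk w * var d - var d * brk w \<in> ml_part (set (d # w))"
      by (simp only: ml_part_diff)
    with that(2) show ?thesis by (rule ml_ringI)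
  qed
  fix g assume "g \<in> syzygy_generators n"
  then show "g \<in> ml_ring n"
    unfolding syzygy_generators_def
  proof (elim UnE CollectE exE conjE)
    fix a b c assume g: "g = brk [a, b] * var c - var c * brk [a, b]"
      and abc: "distinct [a, b, c]" "{a, b, c} \<subseteq> {1..n}"
    show ?thesis unfolding g by (rule commutator) (use abc in simp_all)
  next
    fix a b c d assume g: "g = brk [a, b, c] * var d - var d * brk [a, b, c]"
      and abcd: "distinct [a, b, c, d]" "{a, b, c, d} \<subseteq> {1..n}"
    show ?thesis unfolding g by (rule commutator) (use abcd in simp_all)
  qed
qed

lemma ml_ideal_zero: "ml_ideal n I \<Longrightarrow> 0 \<in> I"
  by (simp add: ml_ideal_def)

lemma ml_ideal_add:
  assumes "ml_ideal n I" "S \<subseteq> {1..n}" "f \<in> I" "f \<in> ml_part S" "g \<in> I" "g \<in> ml_part S"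
  shows "f + g \<in> I"
  using assms unfolding ml_ideal_def by (simp only: Int_iff)

lemma ml_ideal_mult:
  assumes "ml_ideal n I" "S \<subseteq> {1..n}" "T \<subseteq> {1..n}" "S \<inter> T = {}"
    and "f \<in> I" "f \<in> ml_part S" "q \<in> ml_part T"
  shows "q * f \<in> I" "f * q \<in> I"
  using assms unfolding ml_ideal_def by (simp_all only: Int_iff)

lemma ml_ideal_uminus:
  assumes "ml_ideal n I" "S \<subseteq> {1..n}" "f \<in> I" "f \<in> ml_part S"
  shows "- f \<in> I"
  using ml_ideal_mult(1)[OF assms(1,2) _ _ assms(3,4) ml_part_one[THEN ml_part_uminus]] by simp

lemma ml_ideal_diff:
  assumes "ml_ideal n I" "S \<subseteq> {1..n}" "f \<in> I" "f \<in> ml_part S" "g \<in> I" "g \<in> ml_part S"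
  shows "f - g \<in> I"
  using ml_ideal_add[OF assms(1-4) ml_ideal_uminus[OF assms(1,2,5,6)] ml_part_uminus[OF assms(6)]]
  by simp

section \<open>Brackets are central modulo the syzygies\<close>

text \<open>
  Reasoning about an arbitrary ideal that contains the generators, instead of the generated one,
  keeps the calculations below free of the intersection.
\<close>

locale ideal_containing_syzygies =
  fixes n :: nat and I :: "ncpoly set"
  assumes ideal: "ml_ideal n I" and generators: "syzygy_generators n \<subseteq> I"
begin

text \<open>
  Congruence modulo \<open>I\<close> inside one homogeneous component.  Recording the component makes the
  partial operations composable: sums need the same component, products need disjoint ones.
\<close>

definition cong :: "nat set \<Rightarrow> ncpoly \<Rightarrow> ncpoly \<Rightarrow> bool" where
  "cong S f g \<longleftrightarrow> S \<subseteq> {1..n} \<and> f \<in> ml_part S \<and> g \<in> ml_part S \<and> f - g \<in> I"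

lemma cong_refl: "S \<subseteq> {1..n} \<Longrightarrow> f \<in> ml_part S \<Longrightarrow> cong S f f"
  using ml_ideal_zero[OF ideal] by (simp add: cong_def)

lemma cong_trans [trans]: "cong S f g \<Longrightarrow> cong S g h \<Longrightarrow> cong S f h"
  using ml_ideal_add[OF ideal, of S "f - g" "g - h"] by (simp add: cong_def ml_part_diff)

lemma cong_add: "cong S f g \<Longrightarrow> cong S f' g' \<Longrightarrow> cong S (f + f') (g + g')"
  using ml_ideal_add[OF ideal, of S "f - g" "f' - g'"]
  by (auto simp: cong_def ml_part_diff ml_part_add algebra_simps)

lemma cong_mult_left:
  assumes "cong S f g" "q \<in> ml_part T" "T \<subseteq> {1..n}" "S \<inter> T = {}"
  shows "cong (S \<union> T) (q * f) (q * g)"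
proof -
  have "q * (f - g) \<in> I"
    using assms ml_ideal_mult[OF ideal, of S T "f - g" q] by (simp add: cong_def ml_part_diff)
  then show ?thesis
    using assms ml_part_mult[of q T _ S] by (auto simp: cong_def Un_commute Int_commute right_diff_distrib)
qed

lemma cong_mult_right:
  assumes "cong S f g" "q \<in> ml_part T" "T \<subseteq> {1..n}" "S \<inter> T = {}"
  shows "cong (S \<union> T) (f * q) (g * q)"
proof -
  have "(f - g) * q \<in> I"
    using assms ml_ideal_mult[OF ideal, of S T "f - g" q] by (simp add: cong_def ml_part_diff)
  then show ?thesis
    using assms ml_part_mult[of _ S q T] by (auto simp: cong_def left_diff_distrib)
qed

lemma cong_sym: "cong S f g \<Longrightarrow> cong S g f"
  using ml_ideal_uminus[OF ideal, of S "f - g"] by (simp add: cong_def ml_part_diff)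

lemma cong_diff: "cong S f g \<Longrightarrow> cong S f' g' \<Longrightarrow> cong S (f - f') (g - g')"
  using ml_ideal_diff[OF ideal, of S "f - g" "f' - g'"]
  by (auto simp: cong_def ml_part_diff algebra_simps)

definition central :: "nat set \<Rightarrow> ncpoly \<Rightarrow> bool" where
  "central S f \<longleftrightarrow> S \<subseteq> {1..n} \<and> f \<in> ml_part S \<and>
     (\<forall>d \<in> {1..n} - S. cong (insert d S) (f * var d) (var d * f))"

lemma centralI:
  assumes "S \<subseteq> {1..n}" "f \<in> ml_part S"
    and "\<And>d. d \<in> {1..n} - S \<Longrightarrow> f * var d - var d * f \<in> I"
  shows "central S f"
  unfolding central_def cong_def
proof (intro conjI ballI assms)
  fix d assume d: "d \<in> {1..n} - S"
  have "f * var d \<in> ml_part (S \<union> {d})" "var d * f \<in> ml_part ({d} \<union> S)"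
    by (rule ml_part_mult; use assms(2) d in simp)+
  then show "f * var d \<in> ml_part (insert d S)" "var d * f \<in> ml_part (insert d S)"
    by simp_all
qed (use assms(1) in auto)

text \<open>
  Commuting with the variables outside \<open>S\<close> is enough to commute with every word in them: the letters
  are moved past \<open>f\<close> one at a time.
\<close>

lemma central_commutes_word:
  assumes "central S f" "distinct w" "set w \<subseteq> {1..n}" "S \<inter> set w = {}"
  shows "cong (S \<union> set w) (f * Poly_Mapping.single w c) (Poly_Mapping.single w c * f)"
  using assms(2-)
proof (induction w arbitrary: c)
  case Nil
  have "Poly_Mapping.single [] c * f \<in> ml_part S"
    using assms(1) ml_part_mult[of "Poly_Mapping.single [] c" "{}" f S] by (simp add: central_def)
  then show ?case
    using assms(1) by (auto simp: scalar_commutes central_def intro!: cong_refl)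
next
  case (Cons a w)
  have split: "Poly_Mapping.single (a # w) c = var a * Poly_Mapping.single w c"
    by (simp add: mult_single plus_list_def)
  have "cong (insert a S) (f * var a) (var a * f)"
    using assms(1) Cons.prems by (auto simp: central_def)
  then have "cong (insert a S \<union> set w) (f * var a * Poly_Mapping.single w c) (var a * f * Poly_Mapping.single w c)"
    by (rule cong_mult_right) (use Cons.prems in auto)
  moreover have "cong (S \<union> set w \<union> {a}) (var a * (f * Poly_Mapping.single w c)) (var a * (Poly_Mapping.single w c * f))"
    by (rule cong_mult_left[OF Cons.IH]) (use Cons.prems in auto)
  moreover have "insert a S \<union> set w = S \<union> set (a # w)" "S \<union> set w \<union> {a} = S \<union> set (a # w)"
    by auto
  ultimately show ?case
    unfolding split mult.assoc by (simp only: cong_trans[where g = "var a * (f * Poly_Mapping.single w c)"])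
qed

lemma central_mult:
  assumes "central S f" "central T g" "S \<inter> T = {}"
  shows "central (S \<union> T) (f * g)"
proof -
  have "cong (insert d (S \<union> T)) (f * g * var d) (var d * (f * g))" if "d \<in> {1..n} - (S \<union> T)" for d
  proof -
    have "cong (insert d T \<union> S) (f * (g * var d)) (f * (var d * g))"
      by (rule cong_mult_left) (use assms that in \<open>auto simp: central_def\<close>)
    moreover have "cong (insert d S \<union> T) (f * var d * g) (var d * f * g)"
      by (rule cong_mult_right) (use assms that in \<open>auto simp: central_def\<close>)
    moreover have "insert d T \<union> S = insert d (S \<union> T)" "insert d S \<union> T = insert d (S \<union> T)"
      by auto
    ultimately show ?thesis
      unfolding mult.assoc by (simp only: cong_trans[where g = "f * (var d * g)"])
  qed
  then show ?thesis
    using assms by (auto simp: central_def intro: ml_part_mult)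
qed

lemma central_add: "central S f \<Longrightarrow> central S g \<Longrightarrow> central S (f + g)"
  by (auto simp: central_def ml_part_add distrib_left distrib_right intro: cong_add)

lemma central_diff: "central S f \<Longrightarrow> central S g \<Longrightarrow> central S (f - g)"
  by (auto simp: central_def ml_part_diff left_diff_distrib right_diff_distrib intro: cong_diff)

lemma central_cong:
  assumes "cong S f g" "central S g"
  shows "central S f"
proof -
  have "cong (insert d S) (f * var d) (var d * f)" if "d \<in> {1..n} - S" for d
  proof -
    have "cong (S \<union> {d}) (f * var d) (g * var d)"
      by (rule cong_mult_right[OF assms(1)]) (use that in auto)
    also have "cong (S \<union> {d}) (g * var d) (var d * g)"
      using assms(2) that by (simp add: central_def)
    also have "cong (S \<union> {d}) (var d * g) (var d * f)"
      by (rule cong_mult_left[OF cong_sym[OF assms(1)]]) (use that in auto)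
    finally show ?thesis by simp
  qed
  then show ?thesis
    using assms by (auto simp: central_def cong_def)
qed

text \<open>
  For quaternions, a product of three vectors \<open>abc\<close> is the scalar \<open>[abc]\<close> plus the vector
  \<open>[ab]c - [ac]b + [bc]a\<close>.  Substituting this for the first three letters expresses the bracket of a
  long word through brackets of strictly shorter words.  In the free algebra the identity holds
  exactly once the middle term is written as \<open>b[ac]\<close>; only the scalars have to be moved into front
  position modulo \<open>I\<close>.
\<close>

lemma brk_Cons3_cong:
  assumes abcW: "distinct (a # b # c # W)" "set (a # b # c # W) \<subseteq> {1..n}"
    and P: "central {a, b} (brk [a, b])" and Q: "central {a, c} (brk [a, c])"
    and R: "central {b, c} (brk [b, c])" and T: "central {a, b, c} (brk [a, b, c])"
  shows "cong (set (a # b # c # W)) (brk (a # b # c # W))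
    (brk [a, b, c] * brk W + brk [a, b] * brk (c # W) - brk [a, c] * brk (b # W)
      + brk [b, c] * brk (a # W))"
proof -
  define V where "V = Poly_Mapping.single W (1 / 2 :: rat)"
  define V' where "V' = Poly_Mapping.single (rev W) ((- 1) ^ length W / 2 :: rat)"
  let ?S = "set (a # b # c # W)"
  note defs = brk_def V_def V'_def mult_single plus_list_def distrib_left distrib_right
      left_diff_distrib right_diff_distrib
  \<comment> \<open>Splitting the factor 1/2 of the bracket as part of \<open>V\<close> and \<open>V'\<close> makes the bracket of \<open>abcW\<close> a
    combination of \<open>abc\<close> and \<open>cba\<close>, for both of which the expansion is an exact identity.\<close>
  have abc: "var a * var b * var c =
      brk [a, b, c] + brk [a, b] * var c - var b * brk [a, c] + brk [b, c] * var a"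
    by (intro poly_mapping_eqI)
      (use abcW in \<open>auto simp: defs lookup_add lookup_minus lookup_single when_def\<close>)
  have cba: "var c * var b * var a =
      - brk [a, b, c] + var c * brk [a, b] - brk [a, c] * var b + var a * brk [b, c]"
    by (intro poly_mapping_eqI)
      (use abcW in \<open>auto simp: defs lookup_add lookup_minus lookup_single when_def\<close>)
  have brkU: "brk (a # b # c # W) = var a * var b * var c * V - V' * (var c * var b * var a)"
    by (simp add: defs flip: single_uminus)
  have brkW: "brk W = V + V'" and brk1: "brk (d # W) = var d * V - V' * var d" for d
    by (simp_all add: defs flip: single_uminus)
  have sub: "?S \<subseteq> {1..n}" by (rule abcW(2))
  have commute: "cong ?S (p * f) (f * p)"
    if "central X f" "p = Poly_Mapping.single w e" "distinct w" "X \<inter> set w = {}" "?S = X \<union> set w" for X f p w e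
    using central_commutes_word[OF that(1,3) _ that(4), of e] that abcW(2) cong_sym by auto
  have S: "{a, b, c} \<union> set W = ?S" "{a, c} \<union> set W \<union> {b} = ?S"
    by auto
  have T': "cong ?S (V' * brk [a, b, c]) (brk [a, b, c] * V')"
    by (rule commute[OF T, where w = "rev W"]) (use abcW in \<open>auto simp: V'_def\<close>)
  have P': "cong ?S (V' * var c * brk [a, b]) (brk [a, b] * (V' * var c))"
    by (rule commute[OF P, where w = "rev W @ [c]"])
      (use abcW in \<open>auto simp: V'_def mult_single plus_list_def\<close>)
  have R': "cong ?S (V' * var a * brk [b, c]) (brk [b, c] * (V' * var a))"
    by (rule commute[OF R, where w = "rev W @ [a]"])
      (use abcW in \<open>auto simp: V'_def mult_single plus_list_def\<close>)
  have "cong {a, b, c} (var b * brk [a, c]) (brk [a, c] * var b)"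
    using central_commutes_word[OF Q, of "[b]" 1, THEN cong_sym] abcW by (auto simp: insert_commute)
  then have Q1: "cong ?S (var b * brk [a, c] * V) (brk [a, c] * var b * V)"
    unfolding S(1)[symmetric] by (rule cong_mult_right) (use abcW in \<open>auto simp: V_def\<close>)
  have "cong ({a, c} \<union> set W) (V' * brk [a, c]) (brk [a, c] * V')"
    using central_commutes_word[OF Q, of "rev W", THEN cong_sym] abcW by (auto simp: V'_def)
  then have Q2: "cong ?S (V' * brk [a, c] * var b) (brk [a, c] * V' * var b)"
    unfolding S(2)[symmetric] by (rule cong_mult_right) (use abcW in auto)
  have r: "cong ?S (brk [a, b, c] * V) (brk [a, b, c] * V)"
    "cong ?S (brk [a, b] * var c * V) (brk [a, b] * var c * V)"
    "cong ?S (brk [b, c] * var a * V) (brk [b, c] * var a * V)"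
    by (intro cong_refl[OF sub];
        use abcW in \<open>auto simp: brk_def V_def mult_single plus_list_def distrib_right intro!: ml_part_add\<close>)+
  have "cong ?S
    ((brk [a, b, c] * V + V' * brk [a, b, c])
      + (brk [a, b] * var c * V - V' * var c * brk [a, b])
      - (var b * brk [a, c] * V - V' * brk [a, c] * var b)
      + (brk [b, c] * var a * V - V' * var a * brk [b, c]))
    ((brk [a, b, c] * V + brk [a, b, c] * V')
      + (brk [a, b] * var c * V - brk [a, b] * (V' * var c))
      - (brk [a, c] * var b * V - brk [a, c] * V' * var b)
      + (brk [b, c] * var a * V - brk [b, c] * (V' * var a)))"
    by (intro cong_add cong_diff T' P' Q1 Q2 R' r)
  also have "(brk [a, b, c] * V + brk [a, b, c] * V')
      + (brk [a, b] * var c * V - brk [a, b] * (V' * var c))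
      - (brk [a, c] * var b * V - brk [a, c] * V' * var b)
      + (brk [b, c] * var a * V - brk [b, c] * (V' * var a)) =
    brk [a, b, c] * brk W + brk [a, b] * brk (c # W) - brk [a, c] * brk (b # W)
      + brk [b, c] * brk (a # W)"
    unfolding brkW brk1 by (simp only: distrib_left right_diff_distrib mult.assoc)
  also have "(brk [a, b, c] * V + V' * brk [a, b, c])
      + (brk [a, b] * var c * V - V' * var c * brk [a, b])
      - (var b * brk [a, c] * V - V' * brk [a, c] * var b)
      + (brk [b, c] * var a * V - V' * var a * brk [b, c]) = brk (a # b # c # W)"
    unfolding brkU abc cba by (simp add: algebra_simps)
  finally show ?thesis .
qed

text \<open>
  A bracket is the scalar part of a quaternionic product, hence should commute with everything.  The
  generators say this for words of length 2 and 3; brackets of length 1 vanish; longer ones reduce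
  to products of shorter brackets.
\<close>

lemma central_brk:
  "distinct w \<Longrightarrow> set w \<subseteq> {1..n} \<Longrightarrow> central (set w) (brk w)"
proof (induction w rule: length_induct)
  case (1 w)
  have "brk [a, b] * var d - var d * brk [a, b] \<in> syzygy_generators n"
    if "distinct [a, b, d]" "{a, b, d} \<subseteq> {1..n}" for a b d
    unfolding syzygy_generators_def using that by blast
  then have two: "central {a, b} (brk [a, b])" if "a \<noteq> b" "{a, b} \<subseteq> {1..n}" for a b
    by (intro centralI brk_ml_part subsetD[OF generators]) (use that in auto)
  have "brk [a, b, c] * var d - var d * brk [a, b, c] \<in> syzygy_generators n"
    if "distinct [a, b, c, d]" "{a, b, c, d} \<subseteq> {1..n}" for a b c d
    unfolding syzygy_generators_def using that by blast
  then have three: "central {a, b, c} (brk [a, b, c])"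
    if "distinct [a, b, c]" "{a, b, c} \<subseteq> {1..n}" for a b c
    by (intro centralI brk_ml_part subsetD[OF generators]) (use that in auto)
  consider "w = []" | a where "w = [a]" | a b where "w = [a, b]" | a b c where "w = [a, b, c]"
    | a b c d W where "w = a # b # c # d # W"
    by (metis neq_Nil_conv)
  then show ?case
  proof cases
    case 1
    then show ?thesis
      by (auto simp: central_def brk_def mult_single plus_list_def distrib_left distrib_right
          intro!: cong_refl ml_part_add)
  next
    case (2 a)
    then have "brk w = 0"
      by (simp add: brk_def flip: single_add)
    then show ?thesis
      using 2 "1.prems" by (auto simp: central_def intro!: cong_refl)
  next
    case (3 a b)
    then show ?thesis using two[of a b] "1.prems" by simp
  next
    case (4 a b c)
    then show ?thesis using three[of a b c] "1.prems" by simp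
  next
    case (5 a b c d W)
    note prems = "1.prems"[unfolded 5]
    have IH: "central (set u) (brk u)" if "length u < length w" "distinct u" "set u \<subseteq> set w" for u
      using "1.IH" that "1.prems" by auto
    have short: "central {a, b, c} (brk [a, b, c])" "central {a, b} (brk [a, b])"
        "central {a, c} (brk [a, c])" "central {b, c} (brk [b, c])"
      by (rule two three; use prems in simp)+
    have long: "central (set (d # W)) (brk (d # W))" "central (set (c # d # W)) (brk (c # d # W))"
        "central (set (b # d # W)) (brk (b # d # W))" "central (set (a # d # W)) (brk (a # d # W))"
      by (rule IH; use prems 5 in auto)+
    have "central ({a, b, c} \<union> set (d # W)) (brk [a, b, c] * brk (d # W))"
      "central ({a, b} \<union> set (c # d # W)) (brk [a, b] * brk (c # d # W))"
      "central ({a, c} \<union> set (b # d # W)) (brk [a, c] * brk (b # d # W))"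
      "central ({b, c} \<union> set (a # d # W)) (brk [b, c] * brk (a # d # W))"
      by (intro central_mult short long; use prems in auto)+
    moreover have "{a, b, c} \<union> set (d # W) = set w" "{a, b} \<union> set (c # d # W) = set w"
       "{a, c} \<union> set (b # d # W) = set w" "{b, c} \<union> set (a # d # W) = set w"
      using 5 by auto
    ultimately have "central (set w) (brk [a, b, c] * brk (d # W) + brk [a, b] * brk (c # d # W)
        - brk [a, c] * brk (b # d # W) + brk [b, c] * brk (a # d # W))"
      by (metis central_add central_diff)
    moreover have "cong (set w) (brk w) (brk [a, b, c] * brk (d # W) + brk [a, b] * brk (c # d # W)
        - brk [a, c] * brk (b # d # W) + brk [b, c] * brk (a # d # W))"
      unfolding 5 by (rule brk_Cons3_cong) (use prems two three in auto)
    ultimately show ?thesis by (rule central_cong[rotated])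
  qed
qed

text \<open>
  The scalar part of a product is invariant under cyclic rotation.  Here this is the
  centrality of \<open>[U]\<close>, because \<open>[aU] - [Ua]\<close> is the commutator of \<open>a\<close> and \<open>[U]\<close>.
\<close>

lemma brk_rotate:
  assumes "distinct (a # U)" "set (a # U) \<subseteq> {1..n}"
  shows "cong (set (a # U)) (brk (a # U)) (brk (U @ [a]))"
proof -
  have "brk (a # U) - brk (U @ [a]) = var a * brk U - brk U * var a"
    by (simp add: brk_def mult_single plus_list_def distrib_left distrib_right single_uminus)
  moreover have "cong (insert a (set U)) (var a * brk U) (brk U * var a)"
    using central_brk[of U] assms cong_sym by (simp add: central_def)
  ultimately show ?thesis
    using assms unfolding cong_def by (auto intro: brk_ml_part)
qed

end

section \<open>Leading words of the base\<close>

lemma ascending_append: "ascending (u @ v) \<longleftrightarrow> ascending u \<and> ascending v \<and> (\<forall>x\<in>set u. \<forall>y\<in>set v. x < y)"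
  by (simp add: ascending_def sorted_wrt_append)

lemma ascending_extend: "ascending (u @ [t]) \<Longrightarrow> t < x \<Longrightarrow> ascending (u @ [t, x])"
  by (auto simp: ascending_def sorted_wrt_append)

text \<open>
  The obstructions are the leading words of the base elements.  The word \<open>i3 i2 i1\<close> of G3 is the case \<open>V = []\<close> of the words
  \<open>i3 i2 V i1\<close> of G\<open>m\<close>, which leaves two families.
\<close>

definition obstruction :: "nat list \<Rightarrow> bool" where
  "obstruction p \<longleftrightarrow>
     (\<exists>a b c. a < b \<and> b < c \<and> p = [c, a, b]) \<or>
     (\<exists>x y z V. ascending ([x, y, z] @ V) \<and> p = [z, y] @ V @ [x])"

text \<open>
  All base elements are differences of the brackets of a word and of one of its cyclic rotations:
  the last letter moves to the front in G3, and the first letter to the end in G\<open>m\<close>.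
\<close>

definition base_poly :: "nat list \<Rightarrow> ncpoly" where
  "base_poly p = brk p - brk (if length p = 3 then last p # butlast p else tl p @ [hd p])"

lemma syzygy_base_eq: "syzygy_base n = base_poly ` {p. obstruction p \<and> set p \<subseteq> {1..n}}"
proof (intro equalityI subsetI)
  fix g assume "g \<in> syzygy_base n"
  then consider
      (321) a b c where "1 \<le> a" "a < b" "b < c" "c \<le> n" "g = brk [c, b, a] - brk [a, c, b]"
    | (312) a b c where "1 \<le> a" "a < b" "b < c" "c \<le> n" "g = brk [c, a, b] - brk [b, c, a]"
    | (long) x y z V where "V \<noteq> []" "ascending ([x, y, z] @ V)" "set ([x, y, z] @ V) \<subseteq> {1..n}"
        "g = brk ([z, y] @ V @ [x]) - brk ([y] @ V @ [x, z])"
    unfolding syzygy_base_def G3_def Gm_def by blast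
  then show "g \<in> base_poly ` {p. obstruction p \<and> set p \<subseteq> {1..n}}"
  proof cases
    case 321
    then show ?thesis
      by (intro image_eqI[of _ _ "[c, b, a]"])
        (auto simp: base_poly_def obstruction_def ascending_def intro!: exI[of _ "[]"])
  next
    case 312
    then show ?thesis
      by (intro image_eqI[of _ _ "[c, a, b]"]) (auto simp: base_poly_def obstruction_def)
  next
    case long
    then have "obstruction ([z, y] @ V @ [x])"
      unfolding obstruction_def by blast
    with long show ?thesis
      by (intro image_eqI[of _ _ "[z, y] @ V @ [x]"]) (auto simp: base_poly_def)
  qed
next
  fix g assume "g \<in> base_poly ` {p. obstruction p \<and> set p \<subseteq> {1..n}}"
  then obtain p where p: "obstruction p" "set p \<subseteq> {1..n}" "g = base_poly p" by blast
  from p(1) consider (312) a b c where "a < b" "b < c" "p = [c, a, b]"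
    | (321) x y z where "ascending [x, y, z]" "p = [z, y, x]"
    | (long) x y z V where "V \<noteq> []" "ascending ([x, y, z] @ V)" "p = [z, y] @ V @ [x]"
    unfolding obstruction_def by (metis append.right_neutral append_Cons append_Nil)
  then show "g \<in> syzygy_base n"
  proof cases
    case 312
    then have "g = brk [c, a, b] - brk [b, c, a]" "1 \<le> a" "c \<le> n"
      using p(2,3) by (simp_all add: base_poly_def)
    with 312 have "g \<in> G3 n" unfolding G3_def by blast
    then show ?thesis by (simp add: syzygy_base_def)
  next
    case 321
    then have "g = brk [z, y, x] - brk [x, z, y]" "1 \<le> x" "x < y" "y < z" "z \<le> n"
      using p(2,3) by (simp_all add: base_poly_def ascending_def)
    then have "g \<in> G3 n" unfolding G3_def by blast
    then show ?thesis by (simp add: syzygy_base_def)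
  next
    case long
    then have "g = brk ([z, y] @ V @ [x]) - brk ([y] @ V @ [x, z])" "set ([x, y, z] @ V) \<subseteq> {1..n}"
      using p(2,3) by (auto simp: base_poly_def)
    with long(1,2) have "g \<in> Gm n" unfolding Gm_def by blast
    then show ?thesis by (simp add: syzygy_base_def)
  qed
qed

lemma obstruction_distinct: "obstruction p \<Longrightarrow> distinct p"
  by (auto simp: obstruction_def ascending_def strict_sorted_iff)

lemma base_poly_ml_part:
  assumes "obstruction p"
  shows "base_poly p \<in> ml_part (set p)"
proof -
  obtain c r b where p: "p = c # r @ [b]"
    using assms unfolding obstruction_def by (elim disjE exE conjE) auto
  then have "distinct (c # r @ [b])"
    using obstruction_distinct[OF assms] by simp
  then show ?thesis
    by (auto simp: p base_poly_def butlast_append intro!: ml_part_diff brk_ml_part)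
qed

lemma (in ideal_containing_syzygies) base_poly_in_ideal:
  assumes "obstruction p" "set p \<subseteq> {1..n}"
  shows "base_poly p \<in> I"
proof -
  obtain c r b where p: "p = c # r @ [b]"
    using assms(1) unfolding obstruction_def by (elim disjE exE conjE) auto
  have distinct: "distinct (c # r @ [b])"
    using obstruction_distinct[OF assms(1)] p by simp
  show ?thesis
  proof (cases "length p = 3")
    case True
    then have "base_poly p = brk ((c # r) @ [b]) - brk (b # (c # r))"
      by (simp add: base_poly_def p)
    moreover have "cong (set (b # c # r)) (brk ((c # r) @ [b])) (brk (b # (c # r)))"
      by (rule cong_sym[OF brk_rotate]) (use distinct assms(2) p in auto)
    ultimately show ?thesis by (simp only: cong_def)
  next
    case False
    then have "base_poly p = brk (c # (r @ [b])) - brk ((r @ [b]) @ [c])"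
      by (simp add: base_poly_def p)
    moreover have "cong (set (c # r @ [b])) (brk (c # (r @ [b]))) (brk ((r @ [b]) @ [c]))"
      by (rule brk_rotate) (use distinct assms(2) p in auto)
    ultimately show ?thesis by (simp only: cong_def)
  qed
qed

text \<open>
  Writing a polynomial as its leading term plus a rest below it gives access to the leading term
  without unfolding the maximum.
\<close>

lemma lookup_lead:
  fixes w :: "nat list"
  assumes "c \<noteq> 0" "\<forall>k \<in> Poly_Mapping.keys g. k < w"
  shows "Poly_Mapping.lookup (Poly_Mapping.single w c + g) w = c"
    and "w \<in> Poly_Mapping.keys (Poly_Mapping.single w c + g)"
    and "v \<in> Poly_Mapping.keys (Poly_Mapping.single w c + g) \<Longrightarrow> v = w \<or> v < w"
proof -
  show lookup: "Poly_Mapping.lookup (Poly_Mapping.single w c + g) w = c"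
    using assms(2) by (auto simp: lookup_add in_keys_iff)
  then show "w \<in> Poly_Mapping.keys (Poly_Mapping.single w c + g)"
    using assms(1) by (simp add: in_keys_iff)
  show "v = w \<or> v < w" if "v \<in> Poly_Mapping.keys (Poly_Mapping.single w c + g)"
    using that subsetD[OF Poly_Mapping.keys_add[of "Poly_Mapping.single w c" g]] assms by auto
qed

lemma lead_term_add:
  fixes w :: "nat list"
  assumes "c \<noteq> 0" "\<forall>k \<in> Poly_Mapping.keys g. k < w"
  shows "lead_term (Poly_Mapping.single w c + g) = Poly_Mapping.single w c"
proof -
  have "Max (Poly_Mapping.keys (Poly_Mapping.single w c + g)) = w"
    using lookup_lead[OF assms] by (intro Max_eqI) (auto intro: less_imp_le)
  then show ?thesis using lookup_lead(1)[OF assms] by (simp add: lead_term_def)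
qed

lemma lead_term_split:
  fixes f :: ncpoly
  assumes "f \<noteq> 0"
  obtains w c g where "c \<noteq> 0" "f = Poly_Mapping.single w c + g" "\<forall>k \<in> Poly_Mapping.keys g. k < w"
proof -
  define w where "w = Max (Poly_Mapping.keys f)"
  have ne: "Poly_Mapping.keys f \<noteq> {}" using assms by simp
  then have w: "w \<in> Poly_Mapping.keys f" "\<And>v. v \<in> Poly_Mapping.keys f \<Longrightarrow> v \<le> w"
    unfolding w_def by simp_all
  define g where "g = f - Poly_Mapping.single w (Poly_Mapping.lookup f w)"
  have g: "Poly_Mapping.lookup g k = (if k = w then 0 else Poly_Mapping.lookup f k)" for k
    by (simp add: g_def lookup_minus lookup_single when_def)
  have "k < w" if "k \<in> Poly_Mapping.keys g" for k
    using that w(2)[of k] by (auto simp: in_keys_iff g split: if_splits)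
  then show thesis
    using that[of "Poly_Mapping.lookup f w" w g] w(1) by (simp add: g_def in_keys_iff)
qed

lemma keys_brk: "Poly_Mapping.keys (brk w) \<subseteq> {w, rev w}"
  unfolding brk_def
  by (rule order_trans[OF Poly_Mapping.keys_add]) (auto split: if_splits)

lemma base_poly_split:
  assumes "obstruction p"
  obtains g where "base_poly p = Poly_Mapping.single p (1 / 2) + g" "\<forall>k \<in> Poly_Mapping.keys g. k < p"
proof -
  define q where "q = (if length p = 3 then last p # butlast p else tl p @ [hd p])"
  define g where "g = Poly_Mapping.single (rev p) ((- 1) ^ length p / 2) - brk q"
  have less: "rev p < p \<and> q < p \<and> rev q < p"
    using assms unfolding obstruction_def
  proof (elim disjE exE conjE)
    fix a b c assume "a < b" "b < c" "p = [c, a, b]"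
    then show ?thesis by (simp add: q_def)
  next
    fix x y z V assume "ascending ([x, y, z] @ V)" "p = [z, y] @ V @ [x]"
    then show ?thesis by (cases V) (simp_all add: ascending_def q_def)
  qed
  have "Poly_Mapping.keys g \<subseteq> {rev p, q, rev q}"
    using keys_diff[of "Poly_Mapping.single (rev p) ((- 1) ^ length p / 2)" "brk q"] keys_brk[of q]
    unfolding g_def by (auto split: if_splits)
  then have "\<forall>k \<in> Poly_Mapping.keys g. k < p" using less by blast
  moreover have "base_poly p = Poly_Mapping.single p (1 / 2) + g"
    by (simp add: base_poly_def g_def q_def brk_def[of p])
  ultimately show thesis using that by blast
qed

lemma lead_term_base_poly:
  assumes "obstruction p"
  shows "lead_term (base_poly p) = Poly_Mapping.single p (1 / 2)"
proof -
  obtain g where "base_poly p = Poly_Mapping.single p (1 / 2) + g" "\<forall>k \<in> Poly_Mapping.keys g. k < p"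
    using base_poly_split[OF assms] by blast
  then show ?thesis by (simp add: lead_term_add)
qed

text \<open>
  The first two letters of an obstruction form a descent, and after them comes a further letter
  below the first one.  A word of length 3 has no room for a proper factor of this kind.  A word \<open>zyVx\<close> has its only descents at \<open>zy\<close> and at the last letter \<open>x\<close>, so a
  factor that is an obstruction starts at \<open>z\<close>; as the letters of \<open>V\<close> exceed \<open>z\<close>, it also ends at \<open>x\<close>.
\<close>

lemma obstruction_factor_unique:
  assumes "obstruction (u @ q @ v)" "obstruction q"
  shows "u = [] \<and> v = []"
proof -
  obtain c a r where q: "q = c # a # r" "a < c" "r \<noteq> []"
    using assms(2) unfolding obstruction_def by (elim disjE exE conjE) (auto simp: ascending_def)
  obtain b where b: "b \<in> set r" "b < c"
    using assms(2) unfolding obstruction_def by (elim disjE exE conjE) (auto simp: ascending_def q(1))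
  from assms(1) consider (short) "length (u @ q @ v) = 3"
    | (long) x y z V where "ascending ([x, y, z] @ V)" "u @ q @ v = [z, y] @ V @ [x]"
    unfolding obstruction_def by (elim disjE exE conjE) auto
  then show ?thesis
  proof cases
    case short
    then show ?thesis using q by (cases r) auto
  next
    case long
    show ?thesis
    proof (cases u)
      case (Cons d u')
      then have "u' @ c # a # (r @ v) = (y # V) @ [x]"
        using long(2) q(1) by simp
      then have "butlast (u' @ c # a # (r @ v)) = y # V"
        by (simp only: butlast_snoc)
      then have "y # V = (u' @ [c]) @ a # butlast (r @ v)"
        using q(3) by (simp add: butlast_append)
      moreover have "ascending (y # V)"
        using long(1) by (simp add: ascending_def)
      ultimately have "c < a"
        by (simp only: ascending_append) simp
      then show ?thesis using q(2) by simp
    next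
      case Nil
      have False if "v \<noteq> []"
      proof -
        have "butlast (q @ v) = butlast (([z, y] @ V) @ [x])"
          using long(2) Nil by simp
        then have "q @ butlast v = [z, y] @ V"
          using that by (simp only: butlast_snoc) (simp add: butlast_append)
        then have "c = z" "r @ butlast v = V"
          using q(1) by simp_all
        then have "b \<in> set V" "b < z"
          using b by auto
        then show False using long(1) by (auto simp: ascending_def)
      qed
      then show ?thesis using Nil by blast
    qed
  qed
qed

section \<open>Words without obstructions\<close>

text \<open>
  Pairing each \<open>V\<^bsub>Yi\<^esub>\<close> with its \<open>z\<^sub>i\<close> treats both shapes of a normal word at once: the last block
  \<open>Y\<close> may be empty.
\<close>

definition blocks :: "(nat list \<times> nat) list \<Rightarrow> nat list \<Rightarrow> nat list" where
  "blocks ps Y = concat (map (\<lambda>(Y, z). Y @ [z]) ps) @ Y"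

definition block_form :: "(nat list \<times> nat) list \<Rightarrow> nat list \<Rightarrow> bool" where
  "block_form ps Y \<longleftrightarrow>
     ascending (map snd ps) \<and> ascending (concat (map fst ps) @ Y) \<and>
     (\<forall>(X, z) \<in> set ps. X \<noteq> [] \<and> z < last X)"

text \<open>
  Appending a letter \<open>x\<close> to a word in block form.  After a closed block ending in \<open>tz\<close>, the words \<open>tzx\<close>
  with \<open>x < t\<close> are the obstructions of length 3, so \<open>x\<close> opens a new block.  Within an open block \<open>Y\<close>,
  a larger \<open>x\<close> extends \<open>Y\<close>.  A smaller one closes the block, and it exceeds the \<open>z\<close> that closed
  the block before: otherwise \<open>tzYx\<close> would be an obstruction.
\<close>

lemma block_form_exists:
  assumes "distinct w" "\<And>u p v. w = u @ p @ v \<Longrightarrow> \<not> obstruction p"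
  shows "\<exists>ps Y. w = blocks ps Y \<and> block_form ps Y"
  using assms
proof (induction w rule: rev_induct)
  case Nil
  then show ?case by (intro exI[of _ "[]"]) (simp add: blocks_def block_form_def ascending_def)
next
  case (snoc x w)
  have "\<exists>ps Y. w = blocks ps Y \<and> block_form ps Y"
  proof (rule snoc.IH)
    show "distinct w" using snoc.prems(1) by simp
    show "\<not> obstruction p" if "w = u @ p @ v" for u p v
      using snoc.prems(2)[of u p "v @ [x]"] that by simp
  qed
  then obtain ps Y where w: "w = blocks ps Y" and form: "block_form ps Y" by blast
  show ?case
  proof (cases "Y = []")
    case True
    show ?thesis
    proof (cases ps rule: rev_cases)
      case Nil
      then show ?thesis using True w form
        by (intro exI[of _ "[]"] exI[of _ "[x]"]) (simp add: blocks_def block_form_def ascending_def)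
    next
      case (snoc qs q)
      obtain X z where q: "q = (X, z)" by force
      then obtain X' t where X: "X = X' @ [t]" and zt: "z < t"
        using form snoc by (cases X rule: rev_cases) (auto simp: block_form_def)
      have "w @ [x] = (blocks qs [] @ X') @ [t, z, x] @ []"
        using w True X by (simp add: snoc q blocks_def)
      then have "\<not> obstruction [t, z, x]" using snoc.prems(2) by blast
      moreover have "x \<noteq> t" "x \<noteq> z"
        using \<open>w @ [x] = _\<close> snoc.prems(1) by auto
      moreover have "obstruction [t, z, x]" if "x < z"
        using that zt unfolding obstruction_def ascending_def by (auto intro!: exI[of _ "[]"])
      moreover have "obstruction [t, z, x]" if "z < x" "x < t"
        using that unfolding obstruction_def by blast
      ultimately have "t < x" by (meson linorder_neqE_nat)
      moreover have "concat (map fst ps) = (concat (map fst qs) @ X') @ [t]"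
        using X by (simp add: snoc q)
      ultimately have "block_form ps [x]"
        using form ascending_extend[of "concat (map fst qs) @ X'" t x]
        by (simp add: block_form_def True)
      moreover have "w @ [x] = blocks ps [x]"
        using w True by (simp add: blocks_def)
      ultimately show ?thesis by blast
    qed
  next
    case False
    then obtain Y' t where Y: "Y = Y' @ [t]"
      by (metis append_butlast_last_id)
    have "x \<noteq> t"
      using snoc.prems(1) w by (auto simp: Y blocks_def)
    then consider "t < x" | "x < t" by linarith
    then show ?thesis
    proof cases
      case 1
      then have "block_form ps (Y @ [x])"
        using form ascending_extend[of "concat (map fst ps) @ Y'" t x]
        by (simp add: block_form_def Y)
      moreover have "w @ [x] = blocks ps (Y @ [x])"
        using w by (simp add: blocks_def)
      ultimately show ?thesis by blast
    next
      case 2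
      have "ascending (map snd ps @ [x])"
      proof (cases ps rule: rev_cases)
        case Nil
        then show ?thesis by (simp add: ascending_def)
      next
        case (snoc qs q)
        obtain X z where q: "q = (X, z)" by force
        then obtain X' s where X: "X = X' @ [s]" and zs: "z < s"
          using form snoc by (cases X rule: rev_cases) (auto simp: block_form_def)
        have split: "w @ [x] = (blocks qs [] @ X') @ ([s, z] @ Y @ [x]) @ []"
          using w X by (simp add: snoc q blocks_def)
        then have no: "\<not> obstruction ([s, z] @ Y @ [x])" using snoc.prems(2) by blast
        have "ascending ((concat (map fst qs) @ X') @ [s] @ Y)"
          using form X by (simp add: snoc q block_form_def)
        then have "ascending ([s] @ Y)" unfolding ascending_append by blast
        then have "ascending ([x, z, s] @ Y)" if "x < z"
          using that zs unfolding ascending_def by fastforce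
        then have "\<not> x < z" using no unfolding obstruction_def by blast
        moreover have "x \<noteq> z" using split snoc.prems(1) by auto
        ultimately have "z < x" by simp
        then show ?thesis
          using form ascending_extend[of "map snd qs" z x] by (simp add: snoc q block_form_def)
      qed
      then have "block_form (ps @ [(Y, x)]) []"
        using form 2 by (auto simp: block_form_def Y)
      moreover have "w @ [x] = blocks (ps @ [(Y, x)]) []"
        using w by (simp add: blocks_def)
      ultimately show ?thesis by blast
    qed
  qed
qed

lemma normal_word_blocks:
  assumes "block_form ps Y" "w = blocks ps Y" "distinct w" "set w \<subseteq> {1..n}"
  shows "normal_word n w"
proof -
  have zs: "ascending (map snd ps)" using assms(1) by (simp add: block_form_def)
  have last: "\<forall>i < length ps. snd (ps ! i) < List.last (fst (ps ! i))"
    using assms(1) by (simp add: block_form_def split_beta)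
  have asc: "ascending (concat (map fst ps) @ Y)" using assms(1) by (simp add: block_form_def)
  have each: "ascending X \<and> length X \<ge> 1" if X: "X \<in> set (map fst ps)" for X
  proof -
    obtain us vs where "map fst ps = us @ X # vs" using split_list[OF X] by blast
    then have "ascending (concat us @ X @ concat vs @ Y)" using asc by simp
    then have "ascending X" unfolding ascending_append by blast
    moreover have "X \<noteq> []" using assms(1) X by (auto simp: block_form_def)
    ultimately show ?thesis by (simp add: Suc_le_eq)
  qed
  show ?thesis
  proof (cases "Y = []")
    case True
    then have "w = interleave (map fst ps) (map snd ps)"
      using assms(2) by (simp add: blocks_def interleave_def zip_map_fst_snd)
    moreover have "ascending (concat (map fst ps))"
      using asc True by simp
    ultimately show ?thesis
      unfolding normal_word_def using assms(3,4) zs last each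
      by (intro conjI exI[of _ "length ps"] exI[of _ "map fst ps"] exI[of _ "map snd ps"]) auto
  next
    case False
    have "w = interleave (map fst ps @ [Y]) (map snd ps) @ (map fst ps @ [Y]) ! length ps"
      using assms(2) by (simp add: interleave_def blocks_def zip_append1 zip_map_fst_snd nth_append)
    moreover have "ascending Y" using asc unfolding ascending_append by blast
    then have "\<forall>X \<in> set (map fst ps @ [Y]). ascending X \<and> length X \<ge> 1"
      using each False by (auto simp: Suc_le_eq)
    moreover have "ascending (concat (map fst ps @ [Y]))"
      using asc by simp
    moreover have "\<forall>i < length ps. map snd ps ! i < List.last ((map fst ps @ [Y]) ! i)"
      using last by (simp add: nth_append)
    ultimately show ?thesis
      unfolding normal_word_def using assms(3,4) zs
      by (intro conjI exI[of _ "length ps"] exI[of _ "map fst ps @ [Y]"] exI[of _ "map snd ps"]) simp_all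
  qed
qed

section \<open>Evaluation in matrices\<close>

text \<open>
  Trace-free \<open>2 \<times> 2\<close> matrices are the split form of the vector quaternions and satisfy the same
  syzygies.  They have the advantage of nilpotent elements, which let a single matrix entry
  detect a single word.
\<close>

datatype mat2 = Mat2 rat rat rat rat

instantiation mat2 :: ring_1
begin

definition "0 = Mat2 0 0 0 0"
definition "1 = Mat2 1 0 0 1"
fun plus_mat2 where "Mat2 a b c d + Mat2 a' b' c' d' = Mat2 (a + a') (b + b') (c + c') (d + d')"
fun minus_mat2 where "Mat2 a b c d - Mat2 a' b' c' d' = Mat2 (a - a') (b - b') (c - c') (d - d')"
fun uminus_mat2 where "- Mat2 a b c d = Mat2 (- a) (- b) (- c) (- d)"
fun times_mat2 where
  "Mat2 a b c d * Mat2 a' b' c' d' =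
     Mat2 (a * a' + b * c') (a * b' + b * d') (c * a' + d * c') (c * b' + d * d')"

instance
proof
  fix x y z :: mat2
  show "x * y * z = x * (y * z)" "(x + y) * z = x * z + y * z" "x * (y + z) = x * y + x * z"
    "x + y + z = x + (y + z)"
    by (cases x; cases y; cases z; simp add: algebra_simps)+
  show "x + y = y + x" "x - y = x + - y"
    by (cases x; cases y; simp)+
  show "0 + x = x" "1 * x = x" "x * 1 = x" "- x + x = 0"
    by (cases x; simp add: zero_mat2_def one_mat2_def)+
  show "(0 :: mat2) \<noteq> 1" by (simp add: zero_mat2_def one_mat2_def)
qed

end

definition scalar_mat :: "rat \<Rightarrow> mat2" where "scalar_mat c = Mat2 c 0 0 c"

definition traceless :: "mat2 \<Rightarrow> bool" where "traceless M \<longleftrightarrow> (\<exists>p q r. M = Mat2 p q r (- p))"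

definition evaluate :: "(nat \<Rightarrow> mat2) \<Rightarrow> ncpoly \<Rightarrow> mat2" where
  "evaluate A f =
     (\<Sum>w \<in> Poly_Mapping.keys f. scalar_mat (Poly_Mapping.lookup f w) * prod_list (map A w))"

lemma scalar_mat_simps:
  "scalar_mat 0 = 0" "scalar_mat (a + b) = scalar_mat a + scalar_mat b"
  "scalar_mat (a * b) = scalar_mat a * scalar_mat b" "scalar_mat a * M = M * scalar_mat a"
  by (simp_all add: scalar_mat_def zero_mat2_def) (cases M; simp)

lemma evaluate_superset:
  assumes "finite X" "Poly_Mapping.keys f \<subseteq> X"
  shows "evaluate A f = (\<Sum>w \<in> X. scalar_mat (Poly_Mapping.lookup f w) * prod_list (map A w))"
  unfolding evaluate_def
  by (rule sum.mono_neutral_left) (use assms in \<open>auto simp: in_keys_iff scalar_mat_simps(1)\<close>)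

lemma evaluate_zero [simp]: "evaluate A 0 = 0"
  by (simp add: evaluate_def)

lemma evaluate_single: "evaluate A (Poly_Mapping.single w c) = scalar_mat c * prod_list (map A w)"
  by (subst evaluate_superset[of "{w}"]) auto

lemma evaluate_add: "evaluate A (f + g) = evaluate A f + evaluate A g"
proof -
  let ?X = "Poly_Mapping.keys f \<union> Poly_Mapping.keys g"
  have "evaluate A h = (\<Sum>w \<in> ?X. scalar_mat (Poly_Mapping.lookup h w) * prod_list (map A w))"
    if "h \<in> {f, g, f + g}" for h
    by (rule evaluate_superset) (use that Poly_Mapping.keys_add[of f g] in auto)
  then show ?thesis
    by (simp add: lookup_add scalar_mat_simps(2) distrib_right sum.distrib)
qed

lemma evaluate_diff: "evaluate A (f - g) = evaluate A f - evaluate A g"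
  using evaluate_add[of A "f - g" g] by (simp add: algebra_simps)

lemma evaluate_mult: "evaluate A (f * g) = evaluate A f * evaluate A g"
proof (induction f rule: poly_mapping_monomial_induct)
  case (add f u c)
  have "evaluate A (Poly_Mapping.single u c * g) = evaluate A (Poly_Mapping.single u c) * evaluate A g"
  proof (induction g rule: poly_mapping_monomial_induct)
    case (add g v d)
    have "scalar_mat (c * d) * prod_list (map A (u @ v)) =
        (scalar_mat c * prod_list (map A u)) * (scalar_mat d * prod_list (map A v))"
      using scalar_mat_simps(4)[of d "prod_list (map A u)"]
      by (simp add: scalar_mat_simps(3) mult.assoc[symmetric]) (simp add: mult.assoc)
    with add show ?case
      by (simp add: distrib_left mult_single plus_list_def evaluate_add evaluate_single)
  qed simp
  with add show ?case by (simp add: distrib_right evaluate_add)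
qed simp

lemma evaluate_var: "evaluate A (var a) = A a"
  by (cases "A a") (simp add: evaluate_single scalar_mat_def)

text \<open>
  The bracket of two or three trace-free matrices is a scalar matrix, so every generator evaluates
  to a commutator with a scalar matrix.
\<close>

lemma syzygy_ideal_evaluates_zero:
  assumes A: "\<And>i. traceless (A i)" and f: "f \<in> syzygy_ideal n"
  shows "evaluate A f = 0"
proof -
  let ?K = "{f \<in> ml_ring n. evaluate A f = 0}"
  have ideal: "ml_ideal n ?K"
    using ml_ideal_ring[of n] unfolding ml_ideal_def
    by (simp add: evaluate_add evaluate_mult)
  have two: "evaluate A (brk [a, b]) * A c = A c * evaluate A (brk [a, b])" for a b c
    using A[of a] A[of b] A[of c]
    by (auto simp: traceless_def brk_def evaluate_add evaluate_single scalar_mat_def one_mat2_def algebra_simps)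
  have three: "evaluate A (brk [a, b, c]) * A d = A d * evaluate A (brk [a, b, c])" for a b c d
    using A[of a] A[of b] A[of c] A[of d]
    by (auto simp: traceless_def brk_def evaluate_add evaluate_single scalar_mat_def one_mat2_def algebra_simps)
  have "syzygy_generators n \<subseteq> ?K"
  proof
    fix g assume g: "g \<in> syzygy_generators n"
    then have "evaluate A g = 0"
      unfolding syzygy_generators_def by (auto simp: evaluate_diff evaluate_mult evaluate_var two three)
    then show "g \<in> ?K" using g syzygy_generators_ml_ring by blast
  qed
  then show ?thesis
    using f ideal_generated_least[OF ideal] unfolding syzygy_ideal_def by blast
qed

section \<open>Words separated from smaller words\<close>

text \<open>
  In the upper left entry of a product of these matrices, read from the left, only words survive
  in which \<open>E\<close> and \<open>F\<close> alternate, beginning with \<open>E\<close> and ending with \<open>F\<close>; a factor \<open>H\<close> that is not between an \<open>E\<close> and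
  the \<open>F\<close> following it has no effect.
\<close>

definition mat_E :: mat2 where "mat_E = Mat2 0 1 0 0"
definition mat_F :: mat2 where "mat_F = Mat2 0 0 1 0"
definition mat_H :: mat2 where "mat_H = Mat2 1 0 0 (- 1)"

fun entry11 :: "mat2 \<Rightarrow> rat" where "entry11 (Mat2 a b c d) = a"

lemma entry11_simps:
  "entry11 (mat_H * M) = entry11 M" "entry11 (mat_F * M) = 0" "entry11 (mat_E * (mat_F * M)) = entry11 M"
  "entry11 (scalar_mat c * M) = c * entry11 M" "entry11 0 = 0" "entry11 1 = 1"
  "entry11 (M + N) = entry11 M + entry11 N"
  by (cases M; cases N; simp add: mat_E_def mat_F_def mat_H_def scalar_mat_def zero_mat2_def one_mat2_def)+

text \<open>
  The words whose survival is witnessed by \<open>A\<close> together with the vanishing of every smaller word.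
  Where an \<open>F\<close> would make the entry vanish, all smaller letters still to come are sent to \<open>F\<close>; where
  an \<open>F\<close> is required, it is the smallest letter still to come.  So a word that deviates downwards
  meets an \<open>F\<close> where none is admitted.
\<close>

inductive separating :: "(nat \<Rightarrow> mat2) \<Rightarrow> nat list \<Rightarrow> bool" for A where
  Nil: "separating A []"
| H: "A y = mat_H \<Longrightarrow> (\<And>b. b \<in> set w \<Longrightarrow> b < y \<Longrightarrow> A b = mat_F) \<Longrightarrow> separating A w \<Longrightarrow>
    separating A (y # w)"
| EF: "A t = mat_E \<Longrightarrow> A z = mat_F \<Longrightarrow> z < t \<Longrightarrow> (\<And>b. b \<in> set w \<Longrightarrow> b < t \<Longrightarrow> A b = mat_F) \<Longrightarrow>
    (\<And>b. b \<in> set w \<Longrightarrow> z < b) \<Longrightarrow> separating A w \<Longrightarrow> separating A (t # z # w)"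

lemma separating_entry: "separating A w \<Longrightarrow> entry11 (prod_list (map A w)) = 1"
  by (induction rule: separating.induct) (simp_all add: entry11_simps)

lemma separating_smaller_entry:
  assumes "separating A w" "distinct w" "distinct u" "set u = set w" "u < w"
  shows "entry11 (prod_list (map A u)) = 0"
  using assms
proof (induction arbitrary: u rule: separating.induct)
  case Nil
  then show ?case by simp
next
  case (H y w)
  then obtain b v where u: "u = b # v" by (cases u) auto
  show ?case
  proof (cases "b = y")
    case True
    then have "entry11 (prod_list (map A v)) = 0"
      using H.prems by (intro H.IH) (auto simp: u)
    then show ?thesis using H.hyps(1) by (simp add: u True entry11_simps)
  next
    case False
    then have "b < y" "b \<in> set w" using H.prems by (auto simp: u)
    then show ?thesis using H.hyps(2) by (simp add: u entry11_simps)
  qed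
next
  case (EF t z w)
  then obtain b v where u: "u = b # v" by (cases u) auto
  show ?case
  proof (cases "b = t")
    case True
    then have v: "set v = set (z # w)" "v < z # w" "distinct v"
      using EF.prems by (auto simp: u)
    then obtain c v' where v': "v = c # v'" by (cases v) auto
    have "c = z"
      using v EF.hyps(5)[of c] by (auto simp: v')
    then have "entry11 (prod_list (map A v')) = 0"
      using v EF.prems by (intro EF.IH) (auto simp: v')
    then show ?thesis using EF.hyps(1,2) by (simp add: u True v' \<open>c = z\<close> entry11_simps)
  next
    case False
    then have "b < t" "b \<in> set (z # w)" using EF.prems by (auto simp: u)
    then have "A b = mat_F" using EF.hyps(2,4) by auto
    then show ?thesis by (simp add: u entry11_simps)
  qed
qed

lemma separating_append:
  assumes "separating A v" "ascending X" "\<forall>x \<in> set X. A x = mat_H"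
    and "\<And>x b. x \<in> set X \<Longrightarrow> b \<in> set v \<Longrightarrow> b < x \<Longrightarrow> A b = mat_F"
  shows "separating A (X @ v)"
  using assms
proof (induction X)
  case (Cons x X)
  have "separating A (x # (X @ v))"
  proof (rule separating.H)
    show "separating A (X @ v)"
      by (rule Cons.IH) (use Cons.prems in \<open>auto simp: ascending_def\<close>)
    show "A b = mat_F" if "b \<in> set (X @ v)" "b < x" for b
      using that Cons.prems(2,4) by (force simp: ascending_def)
  qed (use Cons.prems in simp)
  then show ?case by simp
qed simp

lemma set_blocks: "set (blocks ps Y) = set (concat (map fst ps) @ Y) \<union> snd ` set ps"
  by (induction ps) (auto simp: blocks_def)

text \<open>
  A letter of a block \<open>V\<^sub>Y\<close> is smaller than all later letters of blocks, so any smaller letter still to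
  come is some \<open>z\<^sub>j\<close>; and each \<open>z\<^sub>i\<close> is below its predecessor \<open>t\<^sub>i\<close> as well as below all later \<open>z\<^sub>j\<close>, hence below
  everything that follows.
\<close>

lemma separating_blocks:
  assumes "block_form ps Y" "\<forall>(X, z) \<in> set ps. A z = mat_F \<and> A (last X) = mat_E \<and> (\<forall>x \<in> set (butlast X). A x = mat_H)"
    and "\<forall>y \<in> set Y. A y = mat_H"
  shows "separating A (blocks ps Y)"
  using assms(1,2)
proof (induction ps)
  case Nil
  then have "separating A (Y @ [])"
    by (intro separating_append separating.Nil) (use assms(3) in \<open>auto simp: block_form_def\<close>)
  then show ?case by (simp add: blocks_def)
next
  case (Cons q ps)
  obtain X z where q: "q = (X, z)" by force
  then obtain X' t where X: "X = X' @ [t]" and zt: "z < t"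
    using Cons.prems(1) by (cases X rule: rev_cases) (auto simp: block_form_def)
  have asc: "ascending (X' @ [t] @ concat (map fst ps) @ Y)" "ascending ([z] @ map snd ps)"
    using Cons.prems(1) by (simp_all add: block_form_def q X)
  have form: "block_form ps Y"
    using Cons.prems(1) asc unfolding block_form_def ascending_append by simp
  have rest: "separating A (blocks ps Y)"
    using Cons.IH[OF form] Cons.prems(2) by simp
  have F: "A b = mat_F" if "b \<in> snd ` set ps" for b
    using Cons.prems(2) that by auto
  have big: "x < b" if "b \<in> set (concat (map fst ps) @ Y)" "x \<in> set (X' @ [t])" for x b
  proof -
    have "ascending ((X' @ [t]) @ (concat (map fst ps) @ Y))" using asc(1) by simp
    then show ?thesis using that unfolding ascending_append[of "X' @ [t]"] by blast
  qed
  have small: "A b = mat_F" if "b \<in> set (blocks ps Y)" "b < x" "x \<in> set (X' @ [t])" for x b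
    using that(1) big[OF _ that(3), of b] F[of b] that(2) unfolding set_blocks by auto
  have "separating A (t # z # blocks ps Y)"
  proof (rule separating.EF[OF _ _ zt _ _ rest])
    show "A t = mat_E" "A z = mat_F" using Cons.prems(2) by (auto simp: q X)
    show "A b = mat_F" if "b \<in> set (blocks ps Y)" "b < t" for b
      using small[OF that] by simp
    show "z < b" if "b \<in> set (blocks ps Y)" for b
      using that unfolding set_blocks
    proof
      assume "b \<in> set (concat (map fst ps) @ Y)"
      then have "t < b" by (rule big) simp
      then show ?thesis using zt by simp
    next
      assume "b \<in> snd ` set ps"
      then show ?thesis using asc(2) by (auto simp: ascending_def)
    qed
  qed
  then have "separating A (X' @ t # z # blocks ps Y)"
  proof (rule separating_append)
    show "ascending X'" using asc(1) unfolding ascending_append by blast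
    show "\<forall>x \<in> set X'. A x = mat_H" using Cons.prems(2) by (simp add: q X)
    show "A b = mat_F" if b: "x \<in> set X'" "b \<in> set (t # z # blocks ps Y)" "b < x" for x b
    proof -
      have "x < t" using asc(1) b(1) by (simp add: ascending_append)
      then consider "b = z" | "b \<in> set (blocks ps Y)" using b by auto
      then show ?thesis
        using small[of b x] b Cons.prems(2) by cases (simp_all add: q)
    qed
  qed
  then show ?case by (simp add: blocks_def q X)
qed

lemma separating_exists:
  assumes "block_form ps Y" "distinct (blocks ps Y)"
  obtains A where "separating A (blocks ps Y)" "\<And>i. traceless (A i)"
proof -
  define A where "A x = (if x \<in> snd ` set ps then mat_F else if x \<in> last ` fst ` set ps then mat_E else mat_H)" for x
  have distinct: "distinct (concat (map fst ps) @ Y)"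
    using assms(1) by (simp add: block_form_def ascending_def strict_sorted_iff del: sorted_wrt_append)
  have disj: "snd ` set ps \<inter> set (concat (map fst ps) @ Y) = {}"
    using assms(2)
  proof (induction ps)
    case (Cons q ps)
    obtain X z where q: "q = (X, z)" by force
    have "distinct (X @ [z] @ blocks ps Y)"
      using Cons.prems by (simp add: q blocks_def)
    then show ?case
      using Cons.IH set_blocks[of ps Y] by (auto simp: q)
  qed simp
  have "separating A (blocks ps Y)"
  proof (rule separating_blocks[OF assms(1)])
    have last_in: "last X \<in> set X" if "X \<in> fst ` set ps" for X
      using assms(1) that by (auto simp: block_form_def)
    then have "x \<notin> last ` fst ` set ps" if "x \<in> set Y" for x
      using distinct that by fastforce
    then show "\<forall>y \<in> set Y. A y = mat_H"
      using disj by (auto simp: A_def)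
    show "\<forall>(X, z) \<in> set ps. A z = mat_F \<and> A (last X) = mat_E \<and> (\<forall>x \<in> set (butlast X). A x = mat_H)"
    proof (intro ballI, clarify, intro conjI ballI)
      fix X z assume Xz: "(X, z) \<in> set ps"
      then have X: "X \<in> fst ` set ps" "z \<in> snd ` set ps" by force+
      then have no_z: "x \<notin> snd ` set ps" if "x \<in> set X" for x
        using disj that by auto
      show "A z = mat_F" using X by (simp add: A_def)
      show "A (last X) = mat_E" using X no_z[OF last_in] by (simp add: A_def)
      fix x assume x: "x \<in> set (butlast X)"
      have "x \<notin> last ` fst ` set ps"
      proof
        assume "x \<in> last ` fst ` set ps"
        then obtain X2 where X2: "X2 \<in> fst ` set ps" "x = last X2" by blast
        then have "x \<in> set X \<inter> set X2"
          using x last_in in_set_butlastD by fastforce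
        then have "X = X2"
          using distinct X(1) X2(1) unfolding distinct_append distinct_concat_iff by auto
        moreover have "distinct X"
          using distinct X(1) unfolding distinct_append distinct_concat_iff by auto
        ultimately show False
          using x X2(2) by (cases X rule: rev_cases) auto
      qed
      then show "A x = mat_H"
        using no_z[OF in_set_butlastD[OF x]] by (simp add: A_def)
    qed
  qed
  moreover have "traceless (A i)" for i
    by (simp add: A_def traceless_def mat_E_def mat_F_def mat_H_def)
  ultimately show thesis using that by blast
qed

section \<open>The Groebner base property\<close>

interpretation syzygies: ideal_containing_syzygies n "syzygy_ideal n" for n
  unfolding syzygy_ideal_def
  by unfold_locales
    (rule ml_ideal_generated[OF syzygy_generators_ml_ring], rule ideal_generated_superset)

lemma syzygy_ideal_ml_ring: "syzygy_ideal n \<subseteq> ml_ring n"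
  using syzygies.ideal[of n] by (simp add: ml_ideal_def)

text \<open>
  Otherwise the leading word \<open>w\<close> is in block form, and the matrix entry separating it from all smaller
  words takes the leading coefficient as its value on \<open>f\<close>, although it vanishes on the ideal.
\<close>

lemma lead_word_has_obstruction:
  assumes f: "f \<in> syzygy_ideal n" "f = Poly_Mapping.single w c + g" "c \<noteq> 0"
    and less: "\<forall>k \<in> Poly_Mapping.keys g. k < w"
  shows "\<exists>u p v. w = u @ p @ v \<and> obstruction p"
proof (rule ccontr)
  assume no: "\<nexists>u p v. w = u @ p @ v \<and> obstruction p"
  obtain S where S: "f \<in> ml_part S"
    using f(1) syzygy_ideal_ml_ring ml_ringE by blast
  note lead = lookup_lead[OF f(3) less, folded f(2)]
  have w: "w \<in> Poly_Mapping.keys f" by (rule lead(2))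
  then have "distinct w" "set w = S"
    using ml_partD[OF S] by auto
  obtain ps Y where ps: "w = blocks ps Y" "block_form ps Y"
    using block_form_exists[OF \<open>distinct w\<close>] no by blast
  obtain A where A: "separating A w" "\<And>i. traceless (A i)"
    using separating_exists[OF ps(2)] \<open>distinct w\<close> ps(1) by blast
  have smaller: "entry11 (prod_list (map A u)) = 0" if "u \<in> Poly_Mapping.keys f - {w}" for u
    using that lead(3)[of u] ml_partD[OF S, of u] \<open>distinct w\<close> \<open>set w = S\<close>
    by (intro separating_smaller_entry[OF A(1)]) auto
  have entry11_sum: "entry11 (\<Sum>u \<in> X. M u) = (\<Sum>u \<in> X. entry11 (M u))" for M and X :: "nat list set"
    by (induction X rule: infinite_finite_induct) (simp_all add: entry11_simps)
  have "entry11 (evaluate A f) =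
      (\<Sum>u \<in> Poly_Mapping.keys f. Poly_Mapping.lookup f u * entry11 (prod_list (map A u)))"
    by (simp add: evaluate_def entry11_sum entry11_simps)
  also have "\<dots> = c * entry11 (prod_list (map A w))"
    using w smaller lead(1) by (subst sum.remove[OF _ w]) simp_all
  also have "\<dots> = c"
    using separating_entry[OF A(1)] by simp
  finally show False
    using syzygy_ideal_evaluates_zero[OF A(2) f(1)] f(3) by (simp add: entry11_simps)
qed

lemma append_less_append:
  fixes u k p v :: "nat list"
  assumes "k < p" "length k = length p"
  shows "u @ k @ v < u @ p @ v"
proof -
  have "k @ v < p @ v"
    using assms(2,1) by (induction rule: list_induct2) auto
  then show ?thesis by (induction u) auto
qed

lemma monomial_mult_keys:
  "Poly_Mapping.keys (Poly_Mapping.single u c * f * Poly_Mapping.single v d) \<subseteq>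
     (\<lambda>k. u @ k @ v) ` Poly_Mapping.keys f"
proof
  fix x assume "x \<in> Poly_Mapping.keys (Poly_Mapping.single u c * f * Poly_Mapping.single v d)"
  then obtain a b where "a \<in> Poly_Mapping.keys (Poly_Mapping.single u c * f)" "x = a @ b"
      "b \<in> Poly_Mapping.keys (Poly_Mapping.single v d)"
    using Poly_Mapping.keys_mult[of "Poly_Mapping.single u c * f" "Poly_Mapping.single v d"]
    by (auto simp: plus_list_def)
  moreover from this(1) obtain a' k where "a' \<in> Poly_Mapping.keys (Poly_Mapping.single u c)"
      "k \<in> Poly_Mapping.keys f" "a = a' @ k"
    using Poly_Mapping.keys_mult[of "Poly_Mapping.single u c" f] by (auto simp: plus_list_def)
  ultimately show "x \<in> (\<lambda>k. u @ k @ v) ` Poly_Mapping.keys f"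
    by (auto split: if_splits)
qed

lemma syzygy_base_ml_ring: "syzygy_base n \<subseteq> ml_ring n"
  using base_poly_ml_part ml_ringI by (auto simp: syzygy_base_eq)

lemma syzygy_base_subset_ideal: "syzygy_base n \<subseteq> syzygy_ideal n"
  using syzygies.base_poly_in_ideal by (auto simp: syzygy_base_eq)

text \<open>
  Division with remainder: subtracting a multiple of a base element removes the leading term and
  stays in the syzygy ideal, whose elements all have reducible leading terms.  The lexicographic order
  on words is not well-founded, but a homogeneous component contains only finitely many words,
  and the induction counts those that do not exceed the leading word.
\<close>

lemma syzygy_ideal_subset_generated: "syzygy_ideal n \<subseteq> ideal_generated n (syzygy_base n)"
proof
  let ?J = "ideal_generated n (syzygy_base n)"
  have J: "ml_ideal n ?J" by (rule ml_ideal_generated[OF syzygy_base_ml_ring])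
  fix f assume "f \<in> syzygy_ideal n"
  moreover from this obtain S where S: "S \<subseteq> {1..n}" "f \<in> ml_part S"
    using syzygy_ideal_ml_ring ml_ringE by blast
  define B where "B f = {v. distinct v \<and> set v = S \<and> (\<exists>k \<in> Poly_Mapping.keys f. v \<le> k)}" for f :: ncpoly
  have "finite {v. distinct v \<and> set v = S}"
    using finite_subset_distinct[of S] S(1) finite_subset
    by (metis (mono_tags, lifting) Collect_mono finite_atLeastAtMost rev_finite_subset subset_refl)
  then have finite: "finite (B f)" for f
    by (rule rev_finite_subset) (auto simp: B_def)
  from \<open>f \<in> syzygy_ideal n\<close> S(2) show "f \<in> ?J"
  proof (induction "card (B f)" arbitrary: f rule: less_induct)
    case less
    show ?case
    proof (cases "f = 0")
      case True
      then show ?thesis using ml_ideal_zero[OF J] by simp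
    next
      case False
      obtain w c g where f: "c \<noteq> 0" "f = Poly_Mapping.single w c + g" "\<forall>k \<in> Poly_Mapping.keys g. k < w"
        using lead_term_split[OF False] by blast
      obtain u p v where w: "w = u @ p @ v" and p: "obstruction p"
        using lead_word_has_obstruction[OF less.prems(1) f(2,1,3)] by blast
      obtain h where h: "base_poly p = Poly_Mapping.single p (1 / 2) + h" "\<forall>k \<in> Poly_Mapping.keys h. k < p"
        using base_poly_split[OF p] by blast
      have w_key: "w \<in> Poly_Mapping.keys f"
        unfolding f(2) by (rule lookup_lead(2)[OF f(1,3)])
      then have wS: "distinct w" "set w = S"
        using ml_partD[OF less.prems(2)] by auto
      \<comment> \<open>The leading coefficient of a base element is 1/2.\<close>
      define l where "l = Poly_Mapping.single u (2 * c)"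
      define r where "r = Poly_Mapping.single v (1 :: rat)"
      have h_part: "h \<in> ml_part (set p)"
        using ml_part_diff[OF base_poly_ml_part[OF p], of "Poly_Mapping.single p (1 / 2)"] wS(1)
        by (simp add: h(1) w)
      have l: "l \<in> ml_part (set u)" and r: "r \<in> ml_part (set v)"
        using wS(1) by (simp_all add: w l_def r_def)
      have sub: "set u \<subseteq> {1..n}" "set p \<subseteq> {1..n}" "set v \<subseteq> {1..n}" "set u \<union> set p \<subseteq> {1..n}"
        using S(1) wS(2) unfolding w by auto
      have disj: "set p \<inter> set u = {}" "set u \<inter> set p = {}" "(set u \<union> set p) \<inter> set v = {}"
        using wS(1) unfolding w by auto
      have lgr: "l * base_poly p * r \<in> I" if "ml_ideal n I" "base_poly p \<in> I" for I
      proof -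
        have "l * base_poly p \<in> I"
          by (rule ml_ideal_mult(1)[OF that(1) sub(2,1) disj(1) that(2) base_poly_ml_part[OF p] l])
        moreover have "l * base_poly p \<in> ml_part (set u \<union> set p)"
          by (rule ml_part_mult[OF l base_poly_ml_part[OF p] disj(2)])
        ultimately show ?thesis
          by (rule ml_ideal_mult(2)[OF that(1) sub(4,3) disj(3) _ _ r])
      qed
      have in_G: "base_poly p \<in> syzygy_base n"
        using p sub(2) by (auto simp: syzygy_base_eq)
      have lgr_part: "l * base_poly p * r \<in> ml_part S"
        using ml_part_mult[OF ml_part_mult[OF l base_poly_ml_part[OF p] disj(2)] r disj(3)] wS(2)
        by (simp add: w Un_assoc)
      define f' where "f' = f - l * base_poly p * r"
      have "f' = g - l * h * r"
        by (simp add: f'_def f(2) h(1) l_def r_def distrib_left distrib_right mult_single plus_list_def w)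
      moreover have "u @ k @ v < w" if "k \<in> Poly_Mapping.keys h" for k
      proof -
        have "length k = length p"
          using ml_partD[OF h_part that] wS(1) by (metis distinct_append distinct_card w)
        then show ?thesis
          using append_less_append h(2) that by (simp add: w)
      qed
      then have "\<forall>k \<in> Poly_Mapping.keys (l * h * r). k < w"
        using monomial_mult_keys[of u "2 * c" h v 1] unfolding l_def r_def by auto
      ultimately have less_w: "\<forall>k \<in> Poly_Mapping.keys f'. k < w"
        using f(3) keys_diff[of g "l * h * r"] by auto
      have "card (B f') < card (B f)"
      proof (rule psubset_card_mono[OF finite])
        have "w \<in> B f" "w \<notin> B f'"
          using w_key wS less_w by (auto simp: B_def)
        moreover have "B f' \<subseteq> B f"
          using less_w w_key unfolding B_def by (auto intro!: bexI[of _ w] dest: order_le_less_trans)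
        ultimately show "B f' \<subset> B f" by blast
      qed
      moreover have "f' \<in> ml_part S"
        unfolding f'_def by (rule ml_part_diff[OF less.prems(2) lgr_part])
      moreover have "f' \<in> syzygy_ideal n"
      proof -
        have "l * base_poly p * r \<in> syzygy_ideal n"
          by (rule lgr[OF syzygies.ideal]) (use in_G syzygy_base_subset_ideal in blast)
        then show ?thesis
          unfolding f'_def by (rule ml_ideal_diff[OF syzygies.ideal S(1) less.prems _ lgr_part])
      qed
      ultimately have "f' \<in> ?J" by (intro less.hyps)
      moreover have "l * base_poly p * r \<in> ?J"
        by (rule lgr[OF J]) (use in_G ideal_generated_superset in blast)
      ultimately have "f' + l * base_poly p * r \<in> ?J"
        by (rule ml_ideal_add[OF J S(1) _ \<open>f' \<in> ml_part S\<close> _ lgr_part])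
      then show ?thesis by (simp add: f'_def)
    qed
  qed
qed

lemma multiplier_single:
  assumes "c \<noteq> 0" "d \<noteq> 0"
  shows "multiplier (Poly_Mapping.single w c) (Poly_Mapping.single p d) \<longleftrightarrow> (\<exists>u v. w = u @ p @ v)"
proof
  assume "multiplier (Poly_Mapping.single w c) (Poly_Mapping.single p d)"
  then obtain u a v b where "Poly_Mapping.single w c =
      Poly_Mapping.single u a * Poly_Mapping.single p d * Poly_Mapping.single v b"
    unfolding multiplier_def is_monomial_def by blast
  then have "Poly_Mapping.single w c = Poly_Mapping.single (u @ p @ v) (a * d * b)"
    by (simp add: mult_single plus_list_def)
  then have "w = u @ p @ v"
    using assms(1) by (metis lookup_single_eq lookup_single_not_eq)
  then show "\<exists>u v. w = u @ p @ v" by blast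
next
  assume "\<exists>u v. w = u @ p @ v"
  then obtain u v where w: "w = u @ p @ v" by blast
  show "multiplier (Poly_Mapping.single w c) (Poly_Mapping.single p d)"
    unfolding multiplier_def is_monomial_def
  proof (intro exI conjI)
    show "Poly_Mapping.single w c =
        Poly_Mapping.single u (c / d) * Poly_Mapping.single p d * Poly_Mapping.single v 1"
      using assms(2) by (simp add: w mult_single plus_list_def)
  qed (use assms in auto)
qed

lemma reduced_groebner_base_syzygy_base:
  "reduced_groebner_base n (syzygy_base n) (syzygy_ideal n)"
  unfolding reduced_groebner_base_def
proof (intro conjI ballI impI)
  show "syzygy_base n \<subseteq> ml_ring n" by (rule syzygy_base_ml_ring)
  show "0 \<notin> syzygy_base n"
  proof
    assume "0 \<in> syzygy_base n"
    then obtain p where "obstruction p" "base_poly p = 0" by (auto simp: syzygy_base_eq)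
    then have "lead_term 0 = Poly_Mapping.single p (1 / 2)"
      using lead_term_base_poly[of p] by simp
    then have "Poly_Mapping.lookup (lead_term 0) p = 1 / 2" by simp
    then show False by (simp add: lead_term_def)
  qed
  show "ideal_generated n (syzygy_base n) = syzygy_ideal n"
    using ideal_generated_least[OF syzygies.ideal syzygy_base_subset_ideal]
      syzygy_ideal_subset_generated by (rule equalityI)
next
  fix f assume f: "f \<in> syzygy_ideal n" "f \<noteq> 0"
  obtain w c g where split: "c \<noteq> 0" "f = Poly_Mapping.single w c + g" "\<forall>k \<in> Poly_Mapping.keys g. k < w"
    using lead_term_split[OF f(2)] by blast
  obtain u p v where w: "w = u @ p @ v" "obstruction p"
    using lead_word_has_obstruction[OF f(1) split(2,1,3)] by blast
  obtain S where S: "S \<subseteq> {1..n}" "f \<in> ml_part S"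
    using f(1) syzygy_ideal_ml_ring ml_ringE by blast
  have "w \<in> Poly_Mapping.keys f"
    unfolding split(2) by (rule lookup_lead(2)[OF split(1,3)])
  then have "set w \<subseteq> {1..n}"
    using ml_partD[OF S(2)] S(1) by simp
  then have "set p \<subseteq> {1..n}"
    by (simp add: w(1))
  then have "base_poly p \<in> syzygy_base n"
    using w(2) by (auto simp: syzygy_base_eq)
  moreover have "multiplier (lead_term f) (lead_term (base_poly p))"
    unfolding split(2) lead_term_add[OF split(1,3)] lead_term_base_poly[OF w(2)]
    by (rule iffD2[OF multiplier_single[OF split(1)]]) (simp, use w(1) in blast)
  ultimately show "\<exists>g \<in> syzygy_base n. multiplier (lead_term f) (lead_term g)" by blast
next
  fix f g assume "f \<in> syzygy_base n" "g \<in> syzygy_base n" "f \<noteq> g"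
  then obtain p q where pq: "obstruction p" "f = base_poly p" "obstruction q" "g = base_poly q" "p \<noteq> q"
    unfolding syzygy_base_eq by blast
  have "\<nexists>u v. p = u @ q @ v"
    using obstruction_factor_unique pq(1,3,5) by fastforce
  then show "reduced_wrt f g"
    by (simp add: reduced_wrt_def pq(2,4) lead_term_base_poly pq(1,3) multiplier_single)
qed

section \<open>Terms of normal forms\<close>

text \<open>
  The words of a base element are rearrangements of its leading word, so reduction introduces
  neither repeated letters nor new ones.
\<close>

lemma reduction_step_multilinear:
  assumes "reduction_step (syzygy_base n) f f'"
    and "\<forall>w \<in> Poly_Mapping.keys f. distinct w \<and> set w \<subseteq> {1..n}"
  shows "\<forall>w \<in> Poly_Mapping.keys f'. distinct w \<and> set w \<subseteq> {1..n}"
proof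
  obtain h g l r where step: "h \<in> terms f" "g \<in> syzygy_base n" "is_monomial l" "is_monomial r"
      "h = l * lead_term g * r" "f' = (f - h) + (h - l * g * r)"
    using assms(1) unfolding reduction_step_def by blast
  obtain p where p: "obstruction p" "g = base_poly p"
    using step(2) unfolding syzygy_base_eq by blast
  obtain w where w: "w \<in> Poly_Mapping.keys f" "h = Poly_Mapping.single w (Poly_Mapping.lookup f w)"
    using step(1) unfolding terms_def by blast
  obtain u a v b where lr: "l = Poly_Mapping.single u a" "r = Poly_Mapping.single v b"
    using step(3,4) unfolding is_monomial_def by blast
  have "Poly_Mapping.single w (Poly_Mapping.lookup f w) = Poly_Mapping.single (u @ p @ v) (a * (1 / 2) * b)"
    using step(5) by (simp add: w(2) lr p lead_term_base_poly mult_single plus_list_def)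
  then have "w = u @ p @ v"
    using w(1) by (metis lookup_single_eq lookup_single_not_eq in_keys_iff)
  fix x assume "x \<in> Poly_Mapping.keys f'"
  then have "x \<in> Poly_Mapping.keys f \<or> x \<in> Poly_Mapping.keys (l * g * r)"
    using keys_diff[of f "l * g * r"] by (auto simp: step(6))
  then show "distinct x \<and> set x \<subseteq> {1..n}"
  proof
    assume "x \<in> Poly_Mapping.keys (l * g * r)"
    then obtain k where k: "k \<in> Poly_Mapping.keys g" "x = u @ k @ v"
      using monomial_mult_keys[of u a g v b] unfolding lr by blast
    then have "distinct k" "set k = set p"
      using ml_partD[OF base_poly_ml_part[OF p(1)]] p(2) by auto
    moreover have "distinct w" "set w \<subseteq> {1..n}"
      using assms(2) w(1) by auto
    ultimately show ?thesis
      unfolding k(2) \<open>w = u @ p @ v\<close> by auto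
  qed (use assms(2) in blast)
qed

lemma normal_form_terms:
  assumes "f \<in> ml_ring n" "is_normal_form_of (syzygy_base n) h f" "t \<in> terms h"
  shows "\<exists>c w. t = Poly_Mapping.single w c \<and> normal_word n w"
proof -
  obtain S where "S \<subseteq> {1..n}" "f \<in> ml_part S"
    using assms(1) by (rule ml_ringE)
  then have f_keys: "\<forall>w \<in> Poly_Mapping.keys f. distinct w \<and> set w \<subseteq> {1..n}"
    using ml_partD by blast
  have "(reduction_step (syzygy_base n))\<^sup>*\<^sup>* f h"
    using assms(2) by (simp add: is_normal_form_of_def)
  then have keys: "\<forall>w \<in> Poly_Mapping.keys h. distinct w \<and> set w \<subseteq> {1..n}"
  proof induction
    case base
    show ?case using f_keys .
  next
    case (step f f')
    show ?case by (rule reduction_step_multilinear[OF step.hyps(2) step.IH])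
  qed
  obtain w where w: "w \<in> Poly_Mapping.keys h" "t = Poly_Mapping.single w (Poly_Mapping.lookup h w)"
    using assms(3) unfolding terms_def by blast
  have "\<not> obstruction p" if "w = u @ p @ v" for u p v
  proof
    assume p: "obstruction p"
    then have "base_poly p \<in> syzygy_base n"
      using keys w(1) that by (auto simp: syzygy_base_eq)
    then have "\<not> multiplier t (lead_term (base_poly p))"
      using assms(2,3) by (simp add: is_normal_form_of_def)
    moreover have "Poly_Mapping.lookup h w \<noteq> 0"
      using w(1) by (simp add: in_keys_iff)
    then have "multiplier t (lead_term (base_poly p))"
      unfolding lead_term_base_poly[OF p] w(2) using that multiplier_single by fastforce
    ultimately show False by blast
  qed
  then obtain ps Y where "w = blocks ps Y" "block_form ps Y"
    using block_form_exists keys w(1) by blast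
  then have "normal_word n w"
    using normal_word_blocks keys w(1) by blast
  then show ?thesis using w(2) by blast
qed

theorem theorem7:
  fixes n :: nat
  assumes "n \<ge> 2"
  shows "reduced_groebner_base n (syzygy_base n) (syzygy_ideal n) \<and>
         (\<forall>f \<in> ml_ring n. \<forall>h. is_normal_form_of (syzygy_base n) h f \<longrightarrow>
            (\<forall>t \<in> terms h. \<exists>c w. t = Poly_Mapping.single w c \<and> normal_word n w))"
  using reduced_groebner_base_syzygy_base normal_form_terms by blast

end
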